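(* For integers $a,b$ with $0<a<b$, the Mordell-Weil rank of $E'_{a,b}(\mathbb{Q})$, where $E'_{a,b}$ is the elliptic curve $y^{2} = x^{3} - a^{2}x + b^{6}$, is at least $3$.
   Context: For an elliptic curve $E$ over $\mathbb{Q}$, the Mordell-Weil rank is the rank $r$ in $E(\mathbb{Q}) \cong \mathbb{Z}^r \oplus E(\mathbb{Q})_{\mathrm{tors}}$. *)

theory Defs
  imports Complex_Main "HOL-Library.Extended_Nat"
begin

datatype ec_point = Inf | Pt rat rat

definition on_curve :: "rat \<Rightarrow> rat \<Rightarrow> ec_point \<Rightarrow> bool" where
  "on_curve A B P = (case P of Inf \<Rightarrow> True | Pt x y \<Rightarrow> y^2 = x^3 + A * x + B)"

definition nonsingular :: "rat \<Rightarrow> rat \<Rightarrow> bool" where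
  "nonsingular A B = (4 * A^3 + 27 * B^2 \<noteq> 0)"

fun ec_add :: "rat \<Rightarrow> rat \<Rightarrow> ec_point \<Rightarrow> ec_point \<Rightarrow> ec_point" where
  "ec_add A B Inf Q = Q"
| "ec_add A B (Pt x1 y1) Inf = Pt x1 y1"
| "ec_add A B (Pt x1 y1) (Pt x2 y2) =
     (if x1 = x2 then
        (if y1 = - y2 then Inf
         else (let l = (3 * x1^2 + A) / (2 * y1);
                   x3 = l^2 - x1 - x2
               in Pt x3 (l * (x1 - x3) - y1)))
      else (let l = (y2 - y1) / (x2 - x1);
                x3 = l^2 - x1 - x2
            in Pt x3 (l * (x1 - x3) - y1)))"

fun ec_neg :: "ec_point \<Rightarrow> ec_point" where
  "ec_neg Inf = Inf"
| "ec_neg (Pt x y) = Pt x (- y)"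

definition ec_mul :: "rat \<Rightarrow> rat \<Rightarrow> int \<Rightarrow> ec_point \<Rightarrow> ec_point" where
  "ec_mul A B n P = (if n \<ge> 0 then (ec_add A B P ^^ nat n) Inf
                     else ec_neg ((ec_add A B P ^^ nat (- n)) Inf))"

definition ec_independent :: "rat \<Rightarrow> rat \<Rightarrow> ec_point list \<Rightarrow> bool" where
  "ec_independent A B ps =
     ((\<forall>P\<in>set ps. on_curve A B P) \<and>
      (\<forall>cs :: int list. length cs = length ps \<longrightarrow>
         foldr (ec_add A B) (map2 (ec_mul A B) cs ps) Inf = Inf \<longrightarrow> (\<forall>c\<in>set cs. c = 0)))"

text \<open>Mordell-Weil rank: the maximal number of Z-independent rational points
  (= rank of the free part of E(Q)).\<close>
definition mw_rank :: "rat \<Rightarrow> rat \<Rightarrow> enat" where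
  "mw_rank A B = (SUP ps \<in> {ps. ec_independent A B ps}. enat (length ps))"

end

theory Submission
  imports Defs "HOL-Computational_Algebra.Polynomial" "HOL-Algebra.Generated_Groups"
begin

text \<open>
  On \<open>y\<^sup>2 = x\<^sup>3 - a\<^sup>2 x + b\<^sup>6\<close> consider \<open>Q\<^sub>1 = (a, b\<^sup>3)\<close>, \<open>Q\<^sub>2 = (-a, b\<^sup>3)\<close> and \<open>R = (-b\<^sup>2, ab)\<close>.
  There is no rational 2-torsion, so by descent the three points are independent as soon as
  every relation \<open>c\<^sub>1 Q\<^sub>1 + c\<^sub>2 Q\<^sub>2 + c\<^sub>3 R = 0\<close> has only even coefficients.
  A point \<open>(x, y)\<close> is a double only if \<open>l\<^sup>4 - 6xl\<^sup>2 - 8yl - 3x\<^sup>2 + 4a\<^sup>2\<close> has a rational root \<open>l\<close>,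
  the slope of the tangent at the half point.
  For \<open>Q\<^sub>1\<close>, \<open>Q\<^sub>2\<close>, \<open>Q\<^sub>1 + Q\<^sub>2\<close> the root would be an integer, and \<open>0 < a < b\<close> leaves no room for it.
  For \<open>R\<close>, \<open>R - Q\<^sub>1\<close>, \<open>R + Q\<^sub>2\<close> the quartic is quadratic in \<open>a\<close>, and its discriminant has to be a
  square; this gives a rational point on a curve of genus one with finitely many rational points,
  which Fermat descent determines.
  The class \<open>Q\<^sub>1 + Q\<^sub>2 + R\<close> can be a double, but only if \<open>b\<^sup>2/a\<close> is divisible by 8 in the
  localisation of the integers at 2. In that case \<open>2Q\<^sub>1\<close>, \<open>2Q\<^sub>2\<close> and \<open>4R\<close> lie in a
  subgroup of the 2-adic filtration that does not contain \<open>2R\<close>, which forces \<open>c\<^sub>3\<close> to be even.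
\<close>

section \<open>The group law\<close>

text \<open>The line \<open>y = lx + m\<close> meets the curve in the points with abscissae \<open>x1\<close>, \<open>x2\<close>, \<open>x3\<close>, counted
  with multiplicity: the three equations compare the coefficients of
  \<open>x\<^sup>3 + Ax + B - (lx + m)\<^sup>2 = (x - x1)(x - x2)(x - x3)\<close>. Chords and tangents are thus treated alike.\<close>

definition coll :: "rat \<Rightarrow> rat \<Rightarrow> rat \<Rightarrow> rat \<Rightarrow> rat \<Rightarrow> rat \<Rightarrow> rat \<Rightarrow> bool" where
  "coll A B l m x1 x2 x3 \<longleftrightarrow>
     l^2 = x1 + x2 + x3 \<and> A - 2*l*m = x1*x2 + x1*x3 + x2*x3 \<and> m^2 - B = x1*x2*x3"

lemma coll_commute: "coll A B l m x1 x2 x3 \<Longrightarrow> coll A B l m x2 x1 x3"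
  and coll_rotate: "coll A B l m x1 x2 x3 \<Longrightarrow> coll A B l m x2 x3 x1"
  and coll_neg: "coll A B l m x1 x2 x3 \<Longrightarrow> coll A B (-l) (-m) x1 x2 x3"
  by (simp_all add: coll_def algebra_simps)

lemma coll_on_curve: "coll A B l m x1 x2 x3 \<Longrightarrow> on_curve A B (Pt x1 (l*x1+m))"
  unfolding coll_def on_curve_def ec_point.case by algebra

text \<open>Up to sign \<open>4*A^3 + 27*B^2\<close> is the resultant of the cubic and its
  derivative, so a common root makes it vanish.\<close>

lemma double_root_singular:
  assumes "x^3 + A*x + B = 0" "3*x^2 + A = 0"
  shows "\<not> nonsingular A B"
  using assms unfolding nonsingular_def by algebra

text \<open>Both branches of \<open>ec_add\<close> recover the slope \<open>l\<close> of the given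
  line, as a difference quotient or, for equal abscissae, as the derivative of the curve.\<close>

lemma ec_add_coll:
  assumes ns: "nonsingular A B" and c: "coll A B l m x1 x2 x3"
  shows "ec_add A B (Pt x1 (l*x1+m)) (Pt x2 (l*x2+m)) = Pt x3 (-(l*x3+m))"
proof (cases "x1 = x2")
  case False
  have "(l*x2+m - (l*x1+m)) / (x2-x1) = l"
    using False by (simp add: field_simps)
  moreover have "x3 = l^2 - x1 - x2" using c by (simp add: coll_def)
  ultimately show ?thesis using False by (simp add: Let_def) (simp add: algebra_simps)
next
  case True
  have d: "3*x1^2 + A = 2*l*(l*x1+m)" using c True unfolding coll_def by algebra
  \<comment> \<open>With ordinate 0, \<open>d\<close> would make \<open>x1\<close> a double root of
    the cubic.\<close>
  have y: "l*x1+m \<noteq> 0"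
  proof
    assume 0: "l*x1+m = 0"
    have "x1^3 + A*x1 + B = 0" using coll_on_curve[OF c] 0 by (simp add: on_curve_def)
    with d 0 double_root_singular ns show False by simp
  qed
  have "(3*x1^2+A) / (2*(l*x1+m)) = l" using d y by (simp add: field_simps)
  moreover have "x3 = l^2 - x1 - x2" using c by (simp add: coll_def)
  moreover have "l*x1+m \<noteq> -(l*x1+m)" using y by (simp add: eq_neg_iff_add_eq_0)
  ultimately show ?thesis using True by (simp add: Let_def) (simp add: algebra_simps)
qed

text \<open>Replaces the case distinctions of \<open>ec_add\<close>: two points are opposite or lie
  on a non-vertical line, which is the tangent when they coincide.\<close>

lemma ec_add_cases:
  assumes "on_curve A B (Pt x1 y1)" "on_curve A B (Pt x2 y2)"
  obtains "x1 = x2" "y1 = - y2"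
  | l m x3 where "coll A B l m x1 x2 x3" "y1 = l*x1+m" "y2 = l*x2+m"
proof -
  have e1: "y1^2 = x1^3 + A*x1 + B" and e2: "y2^2 = x2^3 + A*x2 + B"
    using assms by (simp_all add: on_curve_def)
  consider "x1 = x2" "y1 = - y2" | "x1 = x2" "y1 \<noteq> - y2" | "x1 \<noteq> x2" by blast
  then show thesis
  proof cases
    case 1 then show ?thesis using that(1) by blast
  next
    case 2
    then have "(y1 - y2) * (y1 + y2) = 0" using e1 e2 by (simp add: algebra_simps power2_eq_square)
    with 2 have y: "y1 = y2" "y1 \<noteq> 0" by (auto simp: eq_neg_iff_add_eq_0)
    define l where "l = (3*x1^2 + A) / (2*y1)"
    have "2*l*y1 = 3*x1^2 + A" using y by (simp add: l_def)
    then have "coll A B l (y1 - l*x1) x1 x2 (l^2-x1-x2)"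
      unfolding coll_def using e1 2(1) by (intro conjI) (simp, algebra, algebra)
    then show ?thesis using that(2) 2 y by auto
  next
    case 3
    define l where "l = (y2 - y1) / (x2 - x1)"
    have l: "l * (x2 - x1) = y2 - y1" using 3 by (simp add: l_def)
    have n: "x2 - x1 \<noteq> 0" using 3 by simp
    have "coll A B l (y1 - l*x1) x1 x2 (l^2-x1-x2)"
      unfolding coll_def
    proof (intro conjI)
      show a: "A - 2*l*(y1-l*x1) = x1*x2 + x1*(l^2-x1-x2) + x2*(l^2-x1-x2)"
      proof -
        have "(x2-x1) * (A - 2*l*(y1-l*x1)) = (x2-x1) * (x1*x2 + x1*(l^2-x1-x2) + x2*(l^2-x1-x2))"
          using l e1 e2 by algebra
        then show ?thesis using n by simp
      qed
      show "(y1-l*x1)^2 - B = x1*x2*(l^2-x1-x2)" using a e1 by algebra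
    qed simp
    then show ?thesis using that(2) l by (auto simp: algebra_simps)
  qed
qed

lemma ec_add_commute:
  assumes "on_curve A B p" "on_curve A B q" "nonsingular A B"
  shows "ec_add A B p q = ec_add A B q p"
proof (cases p; cases q)
  fix x1 y1 x2 y2 assume pq: "p = Pt x1 y1" "q = Pt x2 y2"
  have "on_curve A B (Pt x1 y1)" "on_curve A B (Pt x2 y2)" using assms pq by auto
  then show ?thesis
  proof (cases rule: ec_add_cases)
    case 1 then show ?thesis by (simp add: pq)
  next
    case (2 l m x3)
    then show ?thesis
      using ec_add_coll[OF assms(3) 2(1)] ec_add_coll[OF assms(3) coll_commute[OF 2(1)]] pq by simp
  qed
qed auto

lemma on_curve_add:
  assumes "on_curve A B p" "on_curve A B q" "nonsingular A B"
  shows "on_curve A B (ec_add A B p q)"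
proof (cases p; cases q)
  fix x1 y1 x2 y2 assume pq: "p = Pt x1 y1" "q = Pt x2 y2"
  have "on_curve A B (Pt x1 y1)" "on_curve A B (Pt x2 y2)" using assms pq by auto
  then show ?thesis
  proof (cases rule: ec_add_cases)
    case 1 then show ?thesis by (simp add: pq on_curve_def)
  next
    case (2 l m x3)
    have "on_curve A B (Pt x3 (-(l*x3+m)))"
      using coll_on_curve[OF coll_rotate[OF coll_rotate[OF 2(1)]]] by (simp add: on_curve_def power2_eq_square algebra_simps)
    then show ?thesis
      using ec_add_coll[OF assms(3) 2(1)] 2 pq by simp
  qed
qed (use assms in auto)

lemma on_curve_neg: "on_curve A B p \<Longrightarrow> on_curve A B (ec_neg p)"
  by (cases p) (auto simp: on_curve_def)

lemma ec_add_neg: "ec_add A B (ec_neg p) p = Inf"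
  by (cases p) auto

text \<open>Reflecting the line through \<open>p\<close>, \<open>q\<close> and
  \<open>-(p + q)\<close> in the x-axis gives a line through \<open>-p\<close>, \<open>p + q\<close>
  and \<open>-q\<close>.\<close>

lemma ec_neg_add_cancel:
  assumes "on_curve A B p" "on_curve A B q" "nonsingular A B"
  shows "ec_add A B (ec_neg p) (ec_add A B p q) = q"
proof (cases p; cases q)
  fix x1 y1 x2 y2 assume pq: "p = Pt x1 y1" "q = Pt x2 y2"
  have "on_curve A B (Pt x1 y1)" "on_curve A B (Pt x2 y2)" using assms pq by auto
  then show ?thesis
  proof (cases rule: ec_add_cases)
    case 1 then show ?thesis by (simp add: pq)
  next
    case (2 l m x3)
    have "coll A B (-l) (-m) x1 x3 x2"
      using coll_neg[OF coll_rotate[OF coll_commute[OF 2(1)]]] .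
    from ec_add_coll[OF assms(3) this] ec_add_coll[OF assms(3) 2(1)] show ?thesis
      using 2 pq by simp
  qed
qed (auto simp: ec_add_neg[of A B p, simplified])

text \<open>Let \<open>L1\<close> pass through \<open>p, q, u\<close> and \<open>L2\<close> through \<open>q, r, v\<close>. The lines joining \<open>-u\<close> to \<open>r\<close> and \<open>p\<close> to \<open>-v\<close>
  have slopes \<open>l2 + d\<close> and \<open>l1 + d\<close> with \<open>d = (u - v)/(l2 - l1)\<close>; this is seen by shearing \<open>L1\<close> to the
  horizontal axis with \<open>q\<close> at the origin. All claims are then polynomial identities.\<close>

lemma coll_assoc:
  assumes c1: "coll A B l1 m1 x1 x2 u" and c2: "coll A B l2 m2 x2 x3 v"
    and y2: "l1*x2+m1 = l2*x2+m2" and ne: "l1 \<noteq> l2"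
  obtains l3 m3 l4 m4 w where
    "coll A B l3 m3 u x3 w" "coll A B l4 m4 x1 v w"
    "-(l1*u+m1) = l3*u+m3" "l2*x3+m2 = l3*x3+m3"
    "l1*x1+m1 = l4*x1+m4" "-(l2*v+m2) = l4*v+m4" "l3*w+m3 = l4*w+m4"
proof -
  define s where "s = l2 - l1"
  define d where "d = (u - v)/s"
  have s: "s \<noteq> 0" using ne by (simp add: s_def)
  have sd: "s*d = u - v" using s by (simp add: d_def)
  have l2: "l2 = l1 + s" by (simp add: s_def)
  have x2: "x2 = l1^2 - x1 - u" using c1 by (simp add: coll_def)
  have m2: "m2 = m1 - s*x2" using y2 l2 by (simp add: algebra_simps)
  have x3: "x3 = 2*l1*s + s^2 + x1 + u - v"
    using c2 l2 x2 unfolding coll_def by algebra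
  have A1: "A = 2*l1*m1 + x1*x2+x1*u+x2*u" using c1 unfolding coll_def by algebra
  have "2*l2*m2 + x2*x3 + x2*v + x3*v = 2*l1*m1 + x1*x2+x1*u+x2*u"
    using c2 A1 unfolding coll_def by algebra
  \<comment> \<open>Both lines express \<open>A\<close>; equating the two expressions determines the
    ordinate of \<open>q\<close>. With \<open>K\<close> and \<open>sd\<close> the claims below
    become polynomial identities once they are multiplied by \<open>s\<close>.\<close>
  then have K: "s*(2*(l1*x2+m1)) = x1*x2+x1*u+x2*u - x2*x3 - x2*v - x3*v + 2*l2*s*x2 + 2 * s*l1*x2"
    unfolding l2 m2 by algebra
  define l3 where "l3 = l2 + d"
  define m3 where "m3 = -(l1*u+m1) - l3*u"
  define l4 where "l4 = l1 + d"
  define m4 where "m4 = (l1*x1+m1) - l4*x1"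
  define w where "w = l3^2 - u - x3"
  have canc: "s * p = s * q \<Longrightarrow> p = q" for p q using s by simp
  have r: "l2*x3+m2 = l3*x3+m3"
    apply (rule canc)
    using K sd unfolding m3_def l3_def m2 l2 x2 x3 by algebra
  have v: "-(l2*v+m2) = l4*v+m4"
    apply (rule canc)
    using K sd unfolding m4_def l4_def m2 l2 x2 x3 by algebra
  have w2: "l4^2 = x1 + v + w" using sd unfolding w_def l3_def l4_def l2 x3 by algebra
  have ww: "l3*w+m3 = l4*w+m4"
    apply (rule canc)
    using K sd unfolding m4_def l4_def m3_def l3_def m2 l2 x2 x3 w_def by algebra
  have a3: "A - 2*l3*m3 = u*x3 + u*w + x3*w"
    apply (rule canc)
    using K sd unfolding A1 m3_def l3_def m2 l2 x2 x3 w_def by algebra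
  have b3: "m3^2 - B = u*x3*w"
    using a3 coll_on_curve[OF coll_rotate[OF coll_rotate[OF c1]]]
    unfolding on_curve_def ec_point.case w_def m3_def by algebra
  have a4: "A - 2*l4*m4 = x1*v + x1*w + v*w"
    apply (rule canc)
    using K sd unfolding A1 m4_def l4_def l3_def m2 l2 x2 x3 w_def by algebra
  have b4: "m4^2 - B = x1*v*w"
    using a4 w2 coll_on_curve[OF c1]
    unfolding on_curve_def ec_point.case m4_def by algebra
  show thesis
  proof (rule that)
    show "coll A B l3 m3 u x3 w" using a3 b3 by (simp add: coll_def w_def)
    show "coll A B l4 m4 x1 v w" using a4 b4 w2 by (simp add: coll_def)
  qed (use r v ww in \<open>simp_all add: m3_def m4_def\<close>)
qed

text \<open>The abscissae are the roots of one cubic; removing \<open>x2\<close> leaves the pairs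
  \<open>x1, u\<close> and \<open>x3, v\<close> with equal sum and product.\<close>

lemma coll_same_line:
  assumes "coll A B l m x1 x2 u" "coll A B l m x2 x3 v"
  shows "x1 = x3 \<or> x1 = v"
proof -
  have "(x1 - x3) * (x1 - v) = 0" using assms unfolding coll_def by algebra
  then show ?thesis by simp
qed

lemma ec_add_assoc:
  assumes p: "on_curve A B p" and q: "on_curve A B q" and r: "on_curve A B r"
    and ns: "nonsingular A B"
  shows "ec_add A B (ec_add A B p q) r = ec_add A B p (ec_add A B q r)"
proof (cases p; cases q; cases r)
  fix x1 y1 x2 y2 x3 y3 assume pqr: "p = Pt x1 y1" "q = Pt x2 y2" "r = Pt x3 y3"
  have cp: "on_curve A B (Pt x1 y1)" and cq: "on_curve A B (Pt x2 y2)" and cr: "on_curve A B (Pt x3 y3)"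
    using p q r pqr by auto
  from cp cq show ?thesis
  proof (cases rule: ec_add_cases)
    case 1
    then have "p = ec_neg q" by (simp add: pqr)
    then show ?thesis using ec_neg_add_cancel[OF q r ns] ec_add_neg by simp
  next
    case (2 l1 m1 u)
    note c1 = this
    from cq cr show ?thesis
    proof (cases rule: ec_add_cases)
      case 1
      then have r': "r = ec_neg q" by (simp add: pqr)
      have "ec_add A B (ec_add A B p q) r = ec_add A B r (ec_add A B q p)"
        using ec_add_commute on_curve_add assms by metis
      also have "\<dots> = p" using ec_neg_add_cancel[OF q p ns] r' by simp
      finally show ?thesis using ec_add_neg[of A B q] ec_add_commute[OF q r ns] r' pqr by simp
    next
      case (2 l2 m2 v)
      note c2 = this
      have pq: "ec_add A B p q = Pt u (-(l1*u+m1))"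
        using ec_add_coll[OF ns c1(1)] c1 pqr by simp
      have qr: "ec_add A B q r = Pt v (-(l2*v+m2))"
        using ec_add_coll[OF ns c2(1)] c2 pqr by simp
      show ?thesis
      \<comment> \<open>On a single line either \<open>p = r\<close>, or \<open>p + q = -r\<close>
        and \<open>q + r = -p\<close>, so that both sides are \<open>Inf\<close>. On two different
        lines \<open>coll_assoc\<close> supplies the same third point for both sides.\<close>
      proof (cases "l1 = l2")
        case True
        then have m: "m1 = m2" using c1 c2 by simp
        from coll_same_line[of A B l1 m1 x1 x2 u x3 v] True m c1 c2
        consider "x1 = x3" | "x1 = v" by blast
        then show ?thesis
        proof cases
          case 1
          then have "p = r" using True m c1 c2 pqr by simp
          then show ?thesis using ec_add_commute on_curve_add assms by metis
        next
          case 2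
          have "x1 + x2 + u = x2 + x3 + v" using c1(1) c2(1) True by (metis coll_def)
          then have "u = x3" using 2 by simp
          then show ?thesis unfolding pq qr using 2 True m c1 c2 pqr by simp
        qed
      next
        case False
        have "l1*x2+m1 = l2*x2+m2" using c1 c2 by simp
        then obtain l3 m3 l4 m4 w where
          e: "coll A B l3 m3 u x3 w" "coll A B l4 m4 x1 v w"
            "-(l1*u+m1) = l3*u+m3" "l2*x3+m2 = l3*x3+m3"
            "l1*x1+m1 = l4*x1+m4" "-(l2*v+m2) = l4*v+m4" "l3*w+m3 = l4*w+m4"
          by (rule coll_assoc[OF c1(1) c2(1) _ False])
        have "ec_add A B (ec_add A B p q) r = Pt w (-(l3*w+m3))"
          unfolding pq pqr(3) c2(3) e(3,4) by (rule ec_add_coll[OF ns e(1)])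
        moreover have "ec_add A B p (ec_add A B q r) = Pt w (-(l4*w+m4))"
          unfolding qr pqr(1) c1(2) e(5,6) by (rule ec_add_coll[OF ns e(2)])
        ultimately show ?thesis using e(7) by simp
      qed
    qed
  qed
next
  fix x1 y1 assume "p = Pt x1 y1" "q = Inf"
  then show ?thesis by simp
next
  fix x1 y1 x2 y2 assume "p = Pt x1 y1" "q = Pt x2 y2" "r = Inf"
  then show ?thesis using ec_add_commute[OF on_curve_add[OF p q ns] r ns] by simp
qed simp_all

section \<open>The points as an abstract abelian group\<close>

definition ec_group :: "rat \<Rightarrow> rat \<Rightarrow> ec_point monoid" where
  "ec_group A B = \<lparr>carrier = {P. on_curve A B P}, mult = ec_add A B, one = Inf\<rparr>"

lemma ec_group_simps [simp]:
  "P \<in> carrier (ec_group A B) \<longleftrightarrow> on_curve A B P"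
  "P \<otimes>\<^bsub>ec_group A B\<^esub> Q = ec_add A B P Q" "\<one>\<^bsub>ec_group A B\<^esub> = Inf"
  by (simp_all add: ec_group_def)

lemma comm_group_ec_group:
  assumes "nonsingular A B"
  shows "comm_group (ec_group A B)"
proof (rule comm_groupI)
  fix P assume "P \<in> carrier (ec_group A B)"
  then show "\<exists>Q\<in>carrier (ec_group A B). Q \<otimes>\<^bsub>ec_group A B\<^esub> P = \<one>\<^bsub>ec_group A B\<^esub>"
    using on_curve_neg ec_add_neg by (intro bexI[of _ "ec_neg P"]) auto
qed (use assms on_curve_add ec_add_assoc ec_add_commute in \<open>auto simp: on_curve_def[of _ _ Inf]\<close>)

lemma ec_group_inv:
  assumes "nonsingular A B" "on_curve A B P"
  shows "inv\<^bsub>ec_group A B\<^esub> P = ec_neg P"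
proof -
  interpret comm_group "ec_group A B" by (rule comm_group_ec_group[OF assms(1)])
  show ?thesis by (rule inv_equality) (use assms on_curve_neg ec_add_neg in auto)
qed

lemma ec_mul_pow:
  assumes "nonsingular A B" "on_curve A B P"
  shows "ec_mul A B n P = P [^]\<^bsub>ec_group A B\<^esub> n"
proof -
  interpret comm_group "ec_group A B" by (rule comm_group_ec_group[OF assms(1)])
  have nat: "(ec_add A B P ^^ k) Inf = P [^]\<^bsub>ec_group A B\<^esub> k" for k :: nat
  proof (induction k)
    case (Suc k)
    have "P [^]\<^bsub>ec_group A B\<^esub> Suc k = ec_add A B P (P [^]\<^bsub>ec_group A B\<^esub> k)"
      using nat_pow_Suc2[of P k] assms(2) by simp
    then show ?case using Suc by simp
  qed simp
  have "on_curve A B (P [^]\<^bsub>ec_group A B\<^esub> k)" for k :: nat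
    using nat_pow_closed[of P k] assms(2) by simp
  then have "ec_neg (P [^]\<^bsub>ec_group A B\<^esub> k) = inv\<^bsub>ec_group A B\<^esub> (P [^]\<^bsub>ec_group A B\<^esub> k)" for k :: nat
    using ec_group_inv[OF assms(1)] by simp
  then show ?thesis
    unfolding ec_mul_def nat int_pow_def2 by (metis linorder_not_less)
qed

section \<open>Fermat descents\<close>

text \<open>The root is \<open>gcd x z\<close>: its square is
  \<open>gcd (x*x) (x*y) = x * gcd x y = x\<close>.\<close>

lemma coprime_mult_square:
  fixes x y z :: int
  assumes "coprime x y" "x * y = z\<^sup>2" "0 \<le> x"
  obtains m where "x = m\<^sup>2"
proof -
  have "(gcd x z)\<^sup>2 = gcd (x * x) (x * y)" using assms(2) by (simp add: power2_eq_square[of x, symmetric])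
  also have "\<dots> = x * gcd x y" using assms(3) gcd_mult_distrib_int[of x x y] by simp
  also have "\<dots> = x" using assms(1) by simp
  finally show thesis using that by metis
qed

text \<open>Common refinement of two factorisations of one number: \<open>\<alpha>\<close> is the
  gcd of \<open>u\<close> and \<open>r\<close>, and their cofactors are coprime.\<close>

lemma four_number:
  fixes u v r s :: int
  assumes "u * v = r * s" "u \<noteq> 0"
  obtains \<alpha> \<beta> \<gamma> \<delta> where "u = \<alpha> * \<gamma>" "v = \<beta> * \<delta>" "r = \<alpha> * \<beta>" "s = \<gamma> * \<delta>" "coprime \<beta> \<gamma>"
proof -
  define \<alpha> where "\<alpha> = gcd u r"
  have n: "\<alpha> \<noteq> 0" using assms(2) by (simp add: \<alpha>_def)
  obtain \<gamma> \<beta> where g: "u = \<gamma> * \<alpha>" "r = \<beta> * \<alpha>" "coprime \<gamma> \<beta>"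
    using gcd_coprime_exists[of u r] n unfolding \<alpha>_def by metis
  have e: "\<gamma> * v = \<beta> * s" using assms(1) n unfolding g by (simp add: mult_ac)
  then have "\<gamma> dvd s" using g(3) by (metis coprime_dvd_mult_right_iff dvd_triv_left)
  then obtain \<delta> where d: "s = \<gamma> * \<delta>" by blast
  have "\<gamma> \<noteq> 0" using assms(2) g by auto
  then have "v = \<beta> * \<delta>" using e d by simp
  then show thesis using that[of \<alpha> \<gamma> \<beta> \<delta>] g d by (simp add: mult_ac coprime_commute)
qed

lemma odd_square_mod8:
  fixes x :: int
  assumes "odd x" shows "x\<^sup>2 mod 8 = 1"
proof -
  have "x mod 8 = 1 \<or> x mod 8 = 3 \<or> x mod 8 = 5 \<or> x mod 8 = 7" using assms by presburger
  then have "(x mod 8)\<^sup>2 mod 8 = 1" by auto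
  then show ?thesis by (simp add: power_mod)
qed

lemma dvd_3_cases:
  fixes k :: int
  assumes "k dvd 3 * x" "k dvd 3 * y" "coprime x y"
  shows "k \<in> {1, -1, 3, -3}"
proof -
  have "k dvd gcd (3*x) (3*y)" using assms by simp
  also have "\<dots> = 3" using assms(3) by (simp add: gcd_mult_distrib_int[symmetric] coprime_iff_gcd_eq_1)
  finally have "\<bar>k\<bar> dvd 3" by simp
  then have "\<bar>k\<bar> \<le> 3" by (simp add: zdvd_imp_le)
  then have "k \<in> {-3,-2,-1,0,1,2,3}" by auto
  then show ?thesis using \<open>\<bar>k\<bar> dvd 3\<close> by auto
qed

lemma abs_less_mult:
  fixes x y :: int
  assumes "m = 2 * x * y" "m \<noteq> 0"
  shows "\<bar>x\<bar> < \<bar>m\<bar>"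
proof -
  have "x \<noteq> 0" "y \<noteq> 0" using assms by auto
  then have "\<bar>x\<bar> * 2 * 1 \<le> \<bar>x\<bar> * 2 * \<bar>y\<bar>" by (intro mult_left_mono) auto
  then show ?thesis using assms \<open>x \<noteq> 0\<close> by (simp add: abs_mult)
qed

text \<open>Descent on the size of \<open>m\<close>. Each equation is a Pythagorean triple, which
  gives \<open>b = u^2 + v^2 = s^2 + t^2\<close> with \<open>s*t = m = 2*u*v\<close>. Refining
  \<open>u*v = (s/2)*t\<close> into four factors turns the equality of the two sums into a smaller
  solution.\<close>

lemma diff_squares_descent:
  fixes b m n l :: int
  assumes "coprime b m" "b\<^sup>2 = m\<^sup>2 + n\<^sup>2" "b\<^sup>2 = l\<^sup>2 + 4 * m\<^sup>2"
  shows "m = 0"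
  using assms
proof (induction "nat \<bar>m\<bar>" arbitrary: b m n l rule: less_induct)
  case less
  show ?case
  proof (rule ccontr)
    assume m0: "m \<noteq> 0"
    have "\<exists>b. 0 \<le> b \<and> coprime b m \<and> b\<^sup>2 = m\<^sup>2 + n\<^sup>2 \<and> b\<^sup>2 = l\<^sup>2 + 4 * m\<^sup>2"
      using less.prems by (intro exI[of _ "\<bar>b\<bar>"]) simp
    then obtain b where b: "0 \<le> b" "coprime b m" "b\<^sup>2 = m\<^sup>2 + n\<^sup>2" "b\<^sup>2 = l\<^sup>2 + 4 * m\<^sup>2" by blast
    have "odd b"
    proof
      assume "even b"
      then have "odd m" using b(2) by (metis coprime_common_divisor odd_one)
      then have "odd n" using b(3) \<open>even b\<close> by (metis even_add even_power zero_less_numeral)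
      have "b\<^sup>2 mod 4 = 0" using \<open>even b\<close> by auto
      moreover have "m\<^sup>2 mod 8 = 1" "n\<^sup>2 mod 8 = 1" using \<open>odd m\<close> \<open>odd n\<close> odd_square_mod8 by auto
      ultimately show False using b(3) by presburger
    qed
    have "even (b\<^sup>2) \<longleftrightarrow> even (l\<^sup>2)" unfolding b(4) by simp
    then have "odd l" using \<open>odd b\<close> by simp
    have "even m"
    proof (rule ccontr)
      assume "odd m"
      then have "m\<^sup>2 mod 8 = 1" "b\<^sup>2 mod 8 = 1" "l\<^sup>2 mod 8 = 1"
        using \<open>odd b\<close> \<open>odd l\<close> odd_square_mod8 by auto
      then show False using b(4) by presburger
    qed
    then have "odd n" using b(3) \<open>odd b\<close> by (metis even_add even_power)
    \<comment> \<open>Stated for arbitrary \<open>n\<close> and \<open>m1\<close> because both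
      equations are parametrised: \<open>(b + n)/2\<close> and \<open>(b - n)/2\<close> are coprime
      with product \<open>m1^2\<close>.\<close>
    have param: "\<exists>u v. (b + n) div 2 = u\<^sup>2 \<and> (b - n) div 2 = v\<^sup>2 \<and> u * v = m1 \<and> coprime u v"
      if h: "b\<^sup>2 = n\<^sup>2 + 4 * m1\<^sup>2" "odd n" "coprime b m1" for n m1
    proof -
      obtain X where X: "b + n = 2 * X" using \<open>odd b\<close> h(2) by (metis evenE odd_even_add)
      obtain Y where Y: "b - n = 2 * Y" using \<open>odd b\<close> h(2) by (metis evenE even_diff odd_even_add)
      have bXY: "b = X + Y" "n = X - Y" using X Y by auto
      have XY: "X * Y = m1\<^sup>2" using h(1) unfolding bXY by (simp add: power2_eq_square algebra_simps)
      have cop: "coprime X Y"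
      proof (rule coprimeI)
        fix c assume c: "c dvd X" "c dvd Y"
        then have "c dvd b" by (simp add: bXY)
        moreover have "c dvd m1\<^sup>2" using c XY by (metis dvd_mult2)
        moreover have "coprime b (m1\<^sup>2)" using h(3) by simp
        ultimately show "is_unit c" using coprime_common_divisor by blast
      qed
      have "X \<ge> 0 \<and> Y \<ge> 0"
      proof -
        have "X * Y \<ge> 0" using XY by simp
        then show ?thesis using b(1) bXY by (auto simp: zero_le_mult_iff)
      qed
      then obtain u v where uv: "X = u\<^sup>2" "Y = v\<^sup>2"
        using coprime_mult_square[OF cop XY] coprime_mult_square[of Y X m1] cop XY
        by (metis coprime_commute mult.commute)
      have "(u*v)\<^sup>2 = m1\<^sup>2" using XY uv by (simp add: power_mult_distrib)
      then have "u*v = m1 \<or> u*(-v) = m1" by (auto simp: power2_eq_iff)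
      moreover have "coprime u v" using cop uv by simp
      ultimately show ?thesis using X Y uv by (metis coprime_minus_right_iff nonzero_mult_div_cancel_left power2_minus zero_neq_numeral)
    qed
    obtain m1 where m1: "m = 2 * m1" using \<open>even m\<close> by blast
    have cm1: "coprime b m1" using b(2) m1 by simp
    obtain u v where uv: "(b + n) div 2 = u\<^sup>2" "(b - n) div 2 = v\<^sup>2" "u * v = m1"
      using param[of n m1] b(3) m1 \<open>odd n\<close> cm1 by auto
    have "\<exists>s t. s\<^sup>2 + t\<^sup>2 = b \<and> s * t = m \<and> coprime s t \<and> even s"
    proof -
      obtain s t where st: "(b + l) div 2 = s\<^sup>2" "(b - l) div 2 = t\<^sup>2" "s * t = m" "coprime s t"
        using param[of l m] b \<open>odd l\<close> by auto
      have "s\<^sup>2 + t\<^sup>2 = b" unfolding st(1,2)[symmetric] using \<open>odd b\<close> \<open>odd l\<close> by presburger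
      moreover have "even s \<or> even t" using st(3) \<open>even m\<close> by auto
      ultimately show ?thesis using st by (metis add.commute coprime_commute mult.commute)
    qed
    then obtain s t where st: "s\<^sup>2 + t\<^sup>2 = b" "s * t = m" "coprime s t" "even s" by blast
    have uvb: "u\<^sup>2 + v\<^sup>2 = b" unfolding uv(1,2)[symmetric] using \<open>odd b\<close> \<open>odd n\<close> by presburger
    obtain s' where s': "s = 2 * s'" using st(4) by blast
    have "odd t" using st(3,4) by (metis coprime_common_divisor odd_one)
    have "u * v = s' * t" using uv(3) st(2) m1 s' by simp
    moreover have "u \<noteq> 0" using m0 m1 uv(3) by auto
    ultimately obtain \<alpha> \<beta> \<gamma> \<delta> where f: "u = \<alpha> * \<gamma>" "v = \<beta> * \<delta>" "s' = \<alpha> * \<beta>" "t = \<gamma> * \<delta>" "coprime \<beta> \<gamma>"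
      by (rule four_number)
    have mf: "m = 2 * (\<alpha> * \<beta> * \<gamma> * \<delta>)" using st(2) s' f by simp
    have nz: "\<alpha> \<noteq> 0" "\<beta> \<noteq> 0" "\<gamma> \<noteq> 0" "\<delta> \<noteq> 0" using m0 mf by auto
    have ad: "coprime \<alpha> \<delta>" using st(3) s' f by auto
    have odd: "odd \<gamma>" "odd \<delta>" using \<open>odd t\<close> f by auto
    have E: "\<alpha>\<^sup>2 * (\<gamma>\<^sup>2 - 4*\<beta>\<^sup>2) = \<delta>\<^sup>2 * (\<gamma>\<^sup>2 - \<beta>\<^sup>2)"
      using uvb st(1) unfolding s' f by (simp add: power_mult_distrib algebra_simps)
    have "coprime (\<delta>\<^sup>2) (\<alpha>\<^sup>2)" using ad by (simp add: coprime_commute)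
    then have "\<delta>\<^sup>2 dvd \<gamma>\<^sup>2 - 4*\<beta>\<^sup>2" using E by (metis coprime_dvd_mult_right_iff dvd_triv_left)
    then obtain k where k1: "\<gamma>\<^sup>2 - 4*\<beta>\<^sup>2 = \<delta>\<^sup>2 * k" by blast
    have k2: "\<gamma>\<^sup>2 - \<beta>\<^sup>2 = \<alpha>\<^sup>2 * k"
    proof -
      have "\<delta>\<^sup>2 * (\<gamma>\<^sup>2 - \<beta>\<^sup>2) = \<delta>\<^sup>2 * (\<alpha>\<^sup>2 * k)" using E k1 by algebra
      then show ?thesis using nz by simp
    qed
    have "3 * \<beta>\<^sup>2 = k * (\<alpha>\<^sup>2 - \<delta>\<^sup>2)" using k1 k2 by (simp add: algebra_simps)
    moreover have "3 * \<gamma>\<^sup>2 = k * (4 * \<alpha>\<^sup>2 - \<delta>\<^sup>2)" using k1 k2 by (simp add: algebra_simps)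
    ultimately have "k \<in> {1, -1, 3, -3}"
      using f(5) by (intro dvd_3_cases[of k "\<beta>\<^sup>2" "\<gamma>\<^sup>2"]) auto
    \<comment> \<open>By \<open>k1\<close>, \<open>k\<close> is 1 modulo 4, which leaves 1 and -3.
      For \<open>k = 1\<close> the pair \<open>\<gamma>, \<beta>\<close> solves the original system,
      for \<open>k = -3\<close> the pair \<open>\<delta>, \<alpha>\<close> does.\<close>
    moreover have "\<gamma>\<^sup>2 mod 8 = 1" "\<delta>\<^sup>2 mod 8 = 1" using odd odd_square_mod8 by auto
    ultimately consider "k = 1" | "k = -3"
      using k1 k2 by (elim insertE) (auto, presburger+)
    then show False
    proof cases
      case 1
      have "\<bar>\<beta>\<bar> < \<bar>m\<bar>" by (rule abs_less_mult[of _ _ "\<alpha>*\<gamma>*\<delta>"]) (use mf m0 in \<open>auto simp: mult_ac\<close>)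
      then have "\<beta> = 0" using less.hyps[of \<beta> \<gamma> \<alpha> \<delta>] 1 k1 k2 f(5) by (simp add: coprime_commute)
      then show False using nz by simp
    next
      case 2
      have "\<bar>\<alpha>\<bar> < \<bar>m\<bar>" by (rule abs_less_mult[of _ _ "\<beta>*\<gamma>*\<delta>"]) (use mf m0 in \<open>auto simp: mult_ac\<close>)
      moreover have "\<delta>\<^sup>2 = \<alpha>\<^sup>2 + \<beta>\<^sup>2" "\<delta>\<^sup>2 = \<gamma>\<^sup>2 + 4 * \<alpha>\<^sup>2" using 2 k1 k2 by (simp_all add: algebra_simps)
      ultimately have "\<alpha> = 0" using less.hyps[of \<alpha> \<delta> \<beta> \<gamma>] ad by (simp add: coprime_commute)
      then show False using nz by simp
    qed
  qed
qed

text \<open>Descent as in \<open>diff_squares_descent\<close>, now representing \<open>b\<close> up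
  to sign by the form \<open>u^2 - 2*v^2\<close> in two ways. The two signs may agree or differ:
  agreement produces a smaller solution, disagreement is impossible.\<close>

lemma sum_squares_descent:
  fixes b m n h :: int
  assumes "coprime b m" "n\<^sup>2 = b\<^sup>2 + 2 * m\<^sup>2" "h\<^sup>2 = b\<^sup>2 + 8 * m\<^sup>2"
  shows "m = 0"
  using assms
proof (induction "nat \<bar>m\<bar>" arbitrary: b m n h rule: less_induct)
  case less
  note prems = less.prems
  show ?case
  proof (rule ccontr)
    assume m0: "m \<noteq> 0"
    have par: "even (n\<^sup>2) \<longleftrightarrow> even (b\<^sup>2)" "even (h\<^sup>2) \<longleftrightarrow> even (b\<^sup>2)"
      unfolding prems(2,3) by simp_all
    have "odd b"
    proof
      assume "even b"
      then have "odd m" using prems(1) by (metis coprime_common_divisor odd_one)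
      then have "m\<^sup>2 mod 8 = 1" by (rule odd_square_mod8)
      moreover have "b\<^sup>2 mod 4 = 0" "n\<^sup>2 mod 4 = 0" using \<open>even b\<close> par by auto
      ultimately show False using prems(2) by presburger
    qed
    then have "odd n" "odd h" using par by auto
    have "even m"
    proof (rule ccontr)
      assume "odd m"
      then have "m\<^sup>2 mod 8 = 1" "b\<^sup>2 mod 8 = 1" "n\<^sup>2 mod 8 = 1"
        using \<open>odd b\<close> \<open>odd n\<close> odd_square_mod8 by auto
      then show False using prems(2) by presburger
    qed
    have param: "\<exists>u v. (b = u\<^sup>2 - 2 * v\<^sup>2 \<or> - b = u\<^sup>2 - 2 * v\<^sup>2) \<and> u * v = m1 \<and> coprime u v"
      if H: "n\<^sup>2 = b\<^sup>2 + 8 * m1\<^sup>2" "odd n" "coprime b m1" for n m1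
    proof -
      have "\<exists>u v. (b = u\<^sup>2 - 2 * v\<^sup>2 \<or> - b = u\<^sup>2 - 2 * v\<^sup>2) \<and> u * v = m1 \<and> coprime u v"
        if h: "n\<^sup>2 = b\<^sup>2 + 8 * m1\<^sup>2" "odd n" "0 \<le> n" for n
      proof -
        obtain X where X: "n + b = 2 * X" using \<open>odd b\<close> h(2) by (metis evenE odd_even_add)
        obtain Y where Y: "n - b = 2 * Y" using \<open>odd b\<close> h(2) by (metis evenE even_diff odd_even_add)
        have nXY: "n = X + Y" "b = X - Y" using X Y by auto
        have XY: "X * Y = 2 * m1\<^sup>2" using h(1) unfolding nXY by (simp add: power2_eq_square algebra_simps)
        have cop: "coprime X Y"
        proof (rule coprimeI)
          fix c assume c: "c dvd X" "c dvd Y"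
          then have cb: "c dvd b" by (simp add: nXY)
          moreover have "c dvd 2 * m1\<^sup>2" using c XY by (metis dvd_mult2)
          moreover have "coprime b (2 * m1\<^sup>2)" using H(3) \<open>odd b\<close> by simp
          ultimately show "is_unit c" using coprime_common_divisor by blast
        qed
        have pos: "X \<ge> 0 \<and> Y \<ge> 0"
        proof -
          have "X * Y \<ge> 0" using XY by simp
          then show ?thesis using h(3) nXY by (auto simp: zero_le_mult_iff)
        qed
        \<comment> \<open>The factor 2 of \<open>2 * m1^2\<close> lies in only one of the coprime
          factors, here called \<open>Z\<close>.\<close>
        have split: "\<exists>u v. Z = 2 * v\<^sup>2 \<and> W = u\<^sup>2 \<and> u * v = m1 \<and> coprime u v"
          if z: "Z * W = 2 * m1\<^sup>2" "coprime Z W" "0 \<le> Z" "0 \<le> W" "even Z" for Z W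
        proof -
          obtain Z' where Z': "Z = 2 * Z'" using z by blast
          have e: "Z' * W = m1\<^sup>2" using z(1) Z' by simp
          have c: "coprime Z' W" using z(2) Z' by simp
          obtain u v where uv: "Z' = v\<^sup>2" "W = u\<^sup>2"
            using coprime_mult_square[OF c e] coprime_mult_square[of W Z' m1] c e z Z'
            by (metis coprime_commute mult.commute mult_le_cancel_left_pos mult_zero_right zero_less_numeral)
          have "(u*v)\<^sup>2 = m1\<^sup>2" using e uv by (simp add: power_mult_distrib mult.commute)
          then have "u*v = m1 \<or> u*(-v) = m1" by (auto simp: power2_eq_iff)
          moreover have "coprime u v" using c uv by (simp add: coprime_commute)
          ultimately show ?thesis using Z' uv by (metis coprime_minus_right_iff power2_minus)
        qed
        have "even (X * Y)" unfolding XY by simp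
        then consider "even X" | "even Y" by auto
        then show ?thesis
        proof cases
          case 1
          then show ?thesis using split[of X Y] XY cop pos nXY by force
        next
          case 2
          then show ?thesis using split[of Y X] XY cop pos nXY
            by (metis coprime_commute mult.commute)
        qed
      qed
      from this[of "\<bar>n\<bar>"] show ?thesis using H by simp
    qed
    obtain m1 where m1: "m = 2 * m1" using \<open>even m\<close> by blast
    have cm1: "coprime b m1" using prems(1) m1 by simp
    obtain r s where rs: "b = r\<^sup>2 - 2 * s\<^sup>2 \<or> - b = r\<^sup>2 - 2 * s\<^sup>2" "r * s = m1" "coprime r s"
      using param[of n m1] prems(2) m1 \<open>odd n\<close> cm1 by auto
    obtain u v where uv: "b = u\<^sup>2 - 2 * v\<^sup>2 \<or> - b = u\<^sup>2 - 2 * v\<^sup>2" "u * v = m"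
      using param[of h m] prems \<open>odd h\<close> by auto
    have "even (r\<^sup>2 - 2 * s\<^sup>2) \<longleftrightarrow> even b" "even (u\<^sup>2 - 2 * v\<^sup>2) \<longleftrightarrow> even b" using rs(1) uv(1) by (metis even_minus)+
    then have "odd r" "odd u" using \<open>odd b\<close> by auto
    then have "even v" using uv(2) \<open>even m\<close> by auto
    then obtain v' where v': "v = 2 * v'" by blast
    have "u * v' = r * s" using uv(2) rs(2) m1 v' by simp
    moreover have "u \<noteq> 0" using m0 uv(2) by auto
    ultimately obtain \<alpha> \<beta> \<gamma> \<delta> where f: "u = \<alpha> * \<gamma>" "v' = \<beta> * \<delta>" "r = \<alpha> * \<beta>" "s = \<gamma> * \<delta>" "coprime \<beta> \<gamma>"
      by (rule four_number)
    have mf: "m = 2 * (\<alpha> * \<beta> * \<gamma> * \<delta>)" using uv(2) v' f by (simp add: mult_ac)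
    have nz: "\<alpha> \<noteq> 0" "\<beta> \<noteq> 0" "\<gamma> \<noteq> 0" "\<delta> \<noteq> 0" using m0 mf by auto
    have ad: "coprime \<alpha> \<delta>" using rs(3) f by auto
    have odd: "odd \<alpha>" "odd \<beta>" "odd \<gamma>" using \<open>odd r\<close> \<open>odd u\<close> f by auto
    have sq8: "\<alpha>\<^sup>2 mod 8 = 1" "\<beta>\<^sup>2 mod 8 = 1" "\<gamma>\<^sup>2 mod 8 = 1" using odd odd_square_mod8 by auto
    have cop: "coprime (\<alpha>\<^sup>2) (2 * \<delta>\<^sup>2)" using ad odd by simp
    have "r\<^sup>2 - 2 * s\<^sup>2 = u\<^sup>2 - 2 * v\<^sup>2 \<or> r\<^sup>2 - 2 * s\<^sup>2 = -(u\<^sup>2 - 2 * v\<^sup>2)" using rs(1) uv(1) by auto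
    then show False
    proof
      assume "r\<^sup>2 - 2 * s\<^sup>2 = u\<^sup>2 - 2 * v\<^sup>2"
      then have E: "\<alpha>\<^sup>2 * (\<beta>\<^sup>2 - \<gamma>\<^sup>2) = 2 * \<delta>\<^sup>2 * (\<gamma>\<^sup>2 - 4*\<beta>\<^sup>2)"
        unfolding v' f by (simp add: power_mult_distrib algebra_simps)
      then have "\<alpha>\<^sup>2 dvd \<gamma>\<^sup>2 - 4*\<beta>\<^sup>2" using cop by (metis coprime_dvd_mult_right_iff dvd_triv_left)
      then obtain k where k1: "\<gamma>\<^sup>2 - 4*\<beta>\<^sup>2 = \<alpha>\<^sup>2 * k" by blast
      have "\<alpha>\<^sup>2 * (\<beta>\<^sup>2 - \<gamma>\<^sup>2) = \<alpha>\<^sup>2 * (2 * \<delta>\<^sup>2 * k)" using E k1 by (simp add: mult_ac)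
      then have k2: "\<beta>\<^sup>2 - \<gamma>\<^sup>2 = 2 * \<delta>\<^sup>2 * k" using nz by simp
      have "3 * \<beta>\<^sup>2 = k * - (\<alpha>\<^sup>2 + 2 * \<delta>\<^sup>2)" using k1 k2 by (simp add: algebra_simps)
      moreover have "3 * \<gamma>\<^sup>2 = k * - (\<alpha>\<^sup>2 + 8 * \<delta>\<^sup>2)" using k1 k2 by (simp add: algebra_simps)
      ultimately have "k \<in> {1, -1, 3, -3}"
        using f(5) by (intro dvd_3_cases[of k "\<beta>\<^sup>2" "\<gamma>\<^sup>2"]) auto
      \<comment> \<open>Modulo 8 the left side of \<open>k1\<close> is 5 and the square on the right
        is 1.\<close>
      then have "k = -3" using k1 sq8 by (elim insertE) (auto, presburger+)
      then have "\<beta>\<^sup>2 = \<alpha>\<^sup>2 + 2 * \<delta>\<^sup>2" "\<gamma>\<^sup>2 = \<alpha>\<^sup>2 + 8 * \<delta>\<^sup>2" using k1 k2 by simp_all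
      moreover have "\<bar>\<delta>\<bar> < \<bar>m\<bar>" by (rule abs_less_mult[of _ _ "\<alpha>*\<beta>*\<gamma>"]) (use mf m0 in \<open>auto simp: mult_ac\<close>)
      ultimately have "\<delta> = 0" using less.hyps[of \<delta> \<alpha> \<beta> \<gamma>] ad by simp
      then show False using nz by simp
    next
      assume "r\<^sup>2 - 2 * s\<^sup>2 = -(u\<^sup>2 - 2 * v\<^sup>2)"
      then have E: "\<alpha>\<^sup>2 * (\<beta>\<^sup>2 + \<gamma>\<^sup>2) = 2 * \<delta>\<^sup>2 * (\<gamma>\<^sup>2 + 4*\<beta>\<^sup>2)"
        unfolding v' f by (simp add: power_mult_distrib algebra_simps)
      then have "\<alpha>\<^sup>2 dvd \<gamma>\<^sup>2 + 4*\<beta>\<^sup>2" using cop by (metis coprime_dvd_mult_right_iff dvd_triv_left)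
      then obtain k where k1: "\<gamma>\<^sup>2 + 4*\<beta>\<^sup>2 = \<alpha>\<^sup>2 * k" by blast
      have "\<alpha>\<^sup>2 * (\<beta>\<^sup>2 + \<gamma>\<^sup>2) = \<alpha>\<^sup>2 * (2 * \<delta>\<^sup>2 * k)" using E k1 by (simp add: mult_ac)
      then have k2: "\<beta>\<^sup>2 + \<gamma>\<^sup>2 = 2 * \<delta>\<^sup>2 * k" using nz by simp
      have "3 * \<beta>\<^sup>2 = k * (\<alpha>\<^sup>2 - 2 * \<delta>\<^sup>2)" using k1 k2 by (simp add: algebra_simps)
      moreover have "3 * \<gamma>\<^sup>2 = k * (8 * \<delta>\<^sup>2 - \<alpha>\<^sup>2)" using k1 k2 by (simp add: algebra_simps)
      ultimately have "k \<in> {1, -1, 3, -3}"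
        using f(5) by (intro dvd_3_cases[of k "\<beta>\<^sup>2" "\<gamma>\<^sup>2"]) auto
      \<comment> \<open>Here too \<open>k\<close> has to be 5 modulo 8, hence -3, but the sum of
        squares in \<open>k1\<close> is positive.\<close>
      moreover have "k \<noteq> -3"
      proof
        assume "k = -3"
        then have "\<gamma>\<^sup>2 + 4*\<beta>\<^sup>2 \<le> 0" using k1 by simp
        moreover have "0 < \<gamma>\<^sup>2" "0 \<le> \<beta>\<^sup>2" using nz by simp_all
        ultimately show False by linarith
      qed
      ultimately show False using k1 sq8 by (elim insertE) (auto, presburger+)
    qed
  qed
qed

section \<open>Quartic forms that take square values\<close>

text \<open>Opposite parity makes the factors odd coprime squares, whose sum \<open>4*b^2\<close>
  would be 2 modulo 8. For odd \<open>b\<close> and \<open>l\<close> the factors divided by 4 are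
  coprime squares \<open>m^2\<close> and \<open>n^2\<close>, which satisfy the system of
  \<open>diff_squares_descent\<close>.\<close>

lemma square_neg_quartic_int:
  fixes b l w :: int
  assumes "(b\<^sup>2 - l\<^sup>2) * (3 * b\<^sup>2 + l\<^sup>2) = w\<^sup>2" "coprime b l"
  shows "b\<^sup>2 = l\<^sup>2"
proof (cases "even b \<longleftrightarrow> even l")
  case False
  define x y where "x = b\<^sup>2 - l\<^sup>2" and "y = 3 * b\<^sup>2 + l\<^sup>2"
  have xy: "x * y = w\<^sup>2" using assms(1) by (simp add: x_def y_def)
  have odd: "odd x" "odd y" using False by (auto simp: x_def y_def)
  have cop: "coprime x y"
  proof (rule coprimeI)
    fix c assume c: "c dvd x" "c dvd y"
    have "c dvd x + y" "c dvd y - 3 * x" using c by auto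
    then have "c dvd 4 * b\<^sup>2" "c dvd 4 * l\<^sup>2" by (simp_all add: x_def y_def)
    moreover have "odd c" using c odd by auto
    then have "coprime c 4" by (metis coprime_commute coprime_left_2_iff_odd coprime_mult_left_iff mult_2 numeral_Bit0)
    ultimately have "c dvd b\<^sup>2" "c dvd l\<^sup>2" by (metis coprime_dvd_mult_right_iff)+
    moreover have "coprime (b\<^sup>2) (l\<^sup>2)" using assms(2) by simp
    ultimately show "is_unit c" using coprime_common_divisor by blast
  qed
  have "b \<noteq> 0 \<or> l \<noteq> 0" using False by auto
  then have "y > 0" unfolding y_def by (metis add_nonneg_eq_0_iff linorder_not_le mult_nonneg_nonneg power2_eq_square zero_le_numeral zero_le_power2 add_nonneg_nonneg mult_eq_0_iff order_antisym zero_neq_numeral)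
  moreover have "x * y \<ge> 0" unfolding xy by simp
  ultimately have "x \<ge> 0" by (simp add: zero_le_mult_iff)
  then obtain m where m: "x = m\<^sup>2" using coprime_mult_square[OF cop xy] by blast
  obtain n where n: "y = n\<^sup>2" using coprime_mult_square[of y x w] cop xy \<open>y > 0\<close>
    by (metis coprime_commute mult.commute less_imp_le)
  have "odd m" "odd n" using odd m n by auto
  then have "m\<^sup>2 mod 8 = 1" "n\<^sup>2 mod 8 = 1" by (simp_all add: odd_square_mod8)
  moreover have "m\<^sup>2 + n\<^sup>2 = 4 * b\<^sup>2" using m n by (simp add: x_def y_def)
  ultimately show ?thesis by presburger
next
  case True
  then have odd: "odd b" "odd l" using assms(2) by (metis coprime_common_divisor odd_one)+
  then have "b\<^sup>2 mod 8 = 1" "l\<^sup>2 mod 8 = 1" by (simp_all add: odd_square_mod8)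
  then have "4 dvd b\<^sup>2 - l\<^sup>2" by presburger
  then obtain x where x: "b\<^sup>2 - l\<^sup>2 = 4 * x" by blast
  define y where "y = b\<^sup>2 - x"
  have y: "3 * b\<^sup>2 + l\<^sup>2 = 4 * y" using x by (simp add: y_def)
  have "(4::int)\<^sup>2 dvd w\<^sup>2" unfolding assms(1)[symmetric] x y by simp
  then have "4 dvd w" by (simp only: pow_divides_pow_iff zero_less_numeral)
  then obtain w' where w': "w = 4 * w'" by blast
  have xy: "x * y = w'\<^sup>2" using assms(1) unfolding x y w' by (simp add: power2_eq_square)
  have cop: "coprime x y"
  proof (rule coprimeI)
    fix c assume c: "c dvd x" "c dvd y"
    have "b\<^sup>2 = x + y" "l\<^sup>2 = y - 3 * x" using x by (simp_all add: y_def)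
    then have "c dvd b\<^sup>2" "c dvd l\<^sup>2" using c by simp_all
    moreover have "coprime (b\<^sup>2) (l\<^sup>2)" using assms(2) by simp
    ultimately show "is_unit c" using coprime_common_divisor by blast
  qed
  have "b \<noteq> 0" using odd by auto
  then have "0 < b\<^sup>2" "0 \<le> l\<^sup>2" by simp_all
  then have "y > 0" using y by linarith
  moreover have "x * y \<ge> 0" unfolding xy by simp
  ultimately have "x \<ge> 0" by (simp add: zero_le_mult_iff)
  then obtain m where m: "x = m\<^sup>2" using coprime_mult_square[OF cop xy] by blast
  obtain n where n: "y = n\<^sup>2" using coprime_mult_square[of y x w'] cop xy \<open>y > 0\<close>
    by (metis coprime_commute mult.commute less_imp_le)
  have e1: "b\<^sup>2 = m\<^sup>2 + n\<^sup>2" using m n by (simp add: y_def)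
  have e2: "b\<^sup>2 = l\<^sup>2 + 4 * m\<^sup>2" using m x by simp
  have "coprime b m"
  proof (rule coprimeI)
    fix c assume c: "c dvd b" "c dvd m"
    then have "c dvd b\<^sup>2" "c dvd 4 * m\<^sup>2" by (simp_all add: power2_eq_square)
    moreover have "l\<^sup>2 = b\<^sup>2 - 4 * m\<^sup>2" using e2 by simp
    ultimately have "c dvd l\<^sup>2" by simp
    moreover have "coprime b (l\<^sup>2)" using assms(2) by simp
    ultimately show "is_unit c" using coprime_common_divisor c by blast
  qed
  then have "m = 0" by (rule diff_squares_descent[OF _ e1 e2])
  then show ?thesis using e2 by simp
qed

text \<open>Opposite parity makes the left side 2 modulo 4. Otherwise \<open>(h^2 - b^2)/8\<close>
  and \<open>(h^2 + 3*b^2)/4\<close> are coprime squares, which gives the system of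
  \<open>sum_squares_descent\<close>.\<close>

lemma square_double_quartic_int:
  fixes b h w :: int
  assumes "2 * (h\<^sup>2 - b\<^sup>2) * (h\<^sup>2 + 3 * b\<^sup>2) = w\<^sup>2" "coprime b h"
  shows "h\<^sup>2 = b\<^sup>2"
proof (cases "even b \<longleftrightarrow> even h")
  case False
  have "even (w\<^sup>2)" unfolding assms(1)[symmetric] by simp
  then obtain w' where w': "w = 2 * w'" by auto
  have "(h\<^sup>2 - b\<^sup>2) * (h\<^sup>2 + 3 * b\<^sup>2) = 2 * w'\<^sup>2"
    using assms(1) unfolding w' by algebra
  then have "even ((h\<^sup>2 - b\<^sup>2) * (h\<^sup>2 + 3 * b\<^sup>2))" by simp
  then show ?thesis using False by auto
next
  case True
  then have odd: "odd b" "odd h" using assms(2) by (metis coprime_common_divisor odd_one)+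
  then have sq8: "b\<^sup>2 mod 8 = 1" "h\<^sup>2 mod 8 = 1" by (simp_all add: odd_square_mod8)
  then have "8 dvd h\<^sup>2 - b\<^sup>2" by presburger
  then obtain x where x: "h\<^sup>2 - b\<^sup>2 = 8 * x" by blast
  define y where "y = b\<^sup>2 + 2 * x"
  have y: "h\<^sup>2 + 3 * b\<^sup>2 = 4 * y" using x by (simp add: y_def)
  have "64 * (x * y) = w\<^sup>2" using assms(1) unfolding x y by simp
  then have w8: "(8::int)\<^sup>2 * (x * y) = w\<^sup>2" by simp
  then have "(8::int)\<^sup>2 dvd w\<^sup>2" by (metis dvd_triv_left)
  then have "8 dvd w" by (simp only: pow_divides_pow_iff zero_less_numeral)
  then obtain w' where w': "w = 8 * w'" by blast
  have xy: "x * y = w'\<^sup>2" using w8 unfolding w' by (simp add: power2_eq_square)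
  have oy: "odd y" using odd by (simp add: y_def)
  have cop: "coprime x y"
  proof (rule coprimeI)
    fix c assume c: "c dvd x" "c dvd y"
    have "b\<^sup>2 = y - 2 * x" "h\<^sup>2 = y + 6 * x" using x by (simp_all add: y_def)
    then have "c dvd b\<^sup>2" "c dvd h\<^sup>2" using c by simp_all
    moreover have "coprime (b\<^sup>2) (h\<^sup>2)" using assms(2) by simp
    ultimately show "is_unit c" using coprime_common_divisor by blast
  qed
  have "b \<noteq> 0" using odd by auto
  then have "0 < b\<^sup>2" "0 \<le> h\<^sup>2" by simp_all
  then have "y > 0" using y by linarith
  moreover have "x * y \<ge> 0" unfolding xy by simp
  ultimately have "x \<ge> 0" by (simp add: zero_le_mult_iff)
  then obtain m where m: "x = m\<^sup>2" using coprime_mult_square[OF cop xy] by blast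
  obtain n where n: "y = n\<^sup>2" using coprime_mult_square[of y x w'] cop xy \<open>y > 0\<close>
    by (metis coprime_commute mult.commute less_imp_le)
  have e1: "n\<^sup>2 = b\<^sup>2 + 2 * m\<^sup>2" using m n by (simp add: y_def)
  have e2: "h\<^sup>2 = b\<^sup>2 + 8 * m\<^sup>2" using m x by simp
  have "coprime b m"
  proof (rule coprimeI)
    fix c assume c: "c dvd b" "c dvd m"
    then have "c dvd b\<^sup>2" "c dvd 8 * m\<^sup>2" by (simp_all add: power2_eq_square)
    then have "c dvd h\<^sup>2" unfolding e2 by simp
    moreover have "coprime b (h\<^sup>2)" using assms(2) by simp
    ultimately show "is_unit c" using coprime_common_divisor c by blast
  qed
  then have "m = 0" by (rule sum_squares_descent[OF _ e1 e2])
  then show ?thesis using e2 by simp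
qed

section \<open>Rational roots of the halving quartics\<close>

lemma rat_root_int:
  fixes x :: rat
  assumes "x ^ 4 + of_int c3 * x ^ 3 + of_int c2 * x\<^sup>2 + of_int c1 * x + of_int c0 = 0"
  obtains n where "x = of_int n"
proof -
  have "poly (map_poly of_int [:c0, c1, c2, c3, 1:]) x = 0"
    using assms by (simp add: map_poly_pCons algebra_simps power2_eq_square power3_eq_cube power4_eq_xxxx)
  then have "algebraic_int x"
    unfolding algebraic_int_altdef_ipoly by (intro exI[of _ "[:c0, c1, c2, c3, 1:]"]) simp
  moreover have "x \<in> \<rat>" by (simp add: Rats_def)
  ultimately have "x \<in> \<int>" by (rule rational_algebraic_int_is_int)
  then show thesis using that by (auto elim: Ints_cases)
qed

lemma rat_square_int:
  fixes x :: rat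
  assumes "x\<^sup>2 = of_int n"
  obtains w where "x = of_int w"
  \<comment> \<open>\<open>x\<close> is a root of \<open>x^4 - n*x^2\<close>.\<close>
  by (rule rat_root_int[of x 0 "-n" 0 0]) (use assms in \<open>auto simp: power4_eq_xxxx power2_eq_square mult_ac\<close>)

lemma rat_coprime_fraction:
  fixes r :: rat
  obtains p q :: int where "r = of_int p / of_int q" "q \<noteq> 0" "coprime p q"
  by (metis quotient_of_coprime quotient_of_denom_pos quotient_of_div surj_pair less_irrefl)

text \<open>For a reduced fraction \<open>p / q\<close> the homogenised quartic is an integer and a
  rational square, hence the square of an integer.\<close>

lemma square_neg_quartic_rat:
  fixes t w :: rat
  assumes "(1 - t\<^sup>2) * (3 + t\<^sup>2) = w\<^sup>2"
  shows "t\<^sup>2 = 1"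
proof -
  obtain p q where t: "t = of_int p / of_int q" "q \<noteq> 0" "coprime p q" by (rule rat_coprime_fraction)
  define Q P where "Q = (of_int q :: rat)" and "P = (of_int p :: rat)"
  have tQ: "t * Q = P" "Q \<noteq> 0" using t by (simp_all add: Q_def P_def)
  have e: "(Q\<^sup>2 * w)\<^sup>2 = (Q\<^sup>2 - P\<^sup>2) * (3 * Q\<^sup>2 + P\<^sup>2)"
    using assms unfolding tQ(1)[symmetric] by algebra
  then have "(Q\<^sup>2 * w)\<^sup>2 = of_int ((q\<^sup>2 - p\<^sup>2) * (3 * q\<^sup>2 + p\<^sup>2))" by (simp add: Q_def P_def)
  then obtain v where v: "Q\<^sup>2 * w = of_int v" by (rule rat_square_int)
  have "(of_int ((q\<^sup>2 - p\<^sup>2) * (3 * q\<^sup>2 + p\<^sup>2)) :: rat) = of_int (v\<^sup>2)"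
    using e v by (simp add: Q_def P_def)
  then have "(q\<^sup>2 - p\<^sup>2) * (3 * q\<^sup>2 + p\<^sup>2) = v\<^sup>2" by (simp only: of_int_eq_iff)
  then have "q\<^sup>2 = p\<^sup>2" using t(3) by (metis coprime_commute square_neg_quartic_int)
  then have "(of_int (q\<^sup>2) :: rat) = of_int (p\<^sup>2)" by simp
  then have "Q\<^sup>2 = P\<^sup>2" by (simp add: Q_def P_def)
  then have "t\<^sup>2 * Q\<^sup>2 = 1 * Q\<^sup>2" using tQ(1) by algebra
  then show ?thesis using tQ(2) by simp
qed

lemma square_double_quartic_rat:
  fixes h w :: rat
  assumes "2 * (h\<^sup>2 - 1) * (h\<^sup>2 + 3) = w\<^sup>2"
  shows "h\<^sup>2 = 1"
proof -
  obtain p q where t: "h = of_int p / of_int q" "q \<noteq> 0" "coprime p q" by (rule rat_coprime_fraction)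
  define Q P where "Q = (of_int q :: rat)" and "P = (of_int p :: rat)"
  have tQ: "h * Q = P" "Q \<noteq> 0" using t by (simp_all add: Q_def P_def)
  have e: "(Q\<^sup>2 * w)\<^sup>2 = 2 * (P\<^sup>2 - Q\<^sup>2) * (P\<^sup>2 + 3 * Q\<^sup>2)"
    using assms unfolding tQ(1)[symmetric] by algebra
  then have "(Q\<^sup>2 * w)\<^sup>2 = of_int (2 * (p\<^sup>2 - q\<^sup>2) * (p\<^sup>2 + 3 * q\<^sup>2))" by (simp add: Q_def P_def)
  then obtain v where v: "Q\<^sup>2 * w = of_int v" by (rule rat_square_int)
  have "(of_int (2 * (p\<^sup>2 - q\<^sup>2) * (p\<^sup>2 + 3 * q\<^sup>2)) :: rat) = of_int (v\<^sup>2)"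
    using e v by (simp add: Q_def P_def)
  then have "2 * (p\<^sup>2 - q\<^sup>2) * (p\<^sup>2 + 3 * q\<^sup>2) = v\<^sup>2" by (simp only: of_int_eq_iff)
  then have "p\<^sup>2 = q\<^sup>2" using t(3) by (metis coprime_commute square_double_quartic_int)
  then have "(of_int (q\<^sup>2) :: rat) = of_int (p\<^sup>2)" by simp
  then have "Q\<^sup>2 = P\<^sup>2" by (simp add: Q_def P_def)
  then have "h\<^sup>2 * Q\<^sup>2 = 1 * Q\<^sup>2" using tQ(1) by algebra
  then show ?thesis using tQ(2) by simp
qed

text \<open>With \<open>t = l / b\<close> the quartic is quadratic in \<open>a / b^2\<close> with
  vertex \<open>t\<close>; completing the square leaves
  \<open>(2*w)^2 = (1 - t^2)*(3 + t^2)\<close>.\<close>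

lemma halving_quartic_R:
  fixes a b l :: rat
  assumes "l^4 + 6*b\<^sup>2*l\<^sup>2 - 8*a*b*l - 3*b^4 + 4*a\<^sup>2 = 0" "b \<noteq> 0"
  shows "a = b\<^sup>2 \<or> a = - b\<^sup>2"
proof -
  define t where "t = l / b"
  define w where "w = a / b\<^sup>2 - t"
  have l: "l = t * b" using assms(2) by (simp add: t_def)
  have a: "a = (w + t) * b\<^sup>2" using assms(2) by (simp add: w_def)
  have "b^4 * ((1 - t\<^sup>2) * (3 + t\<^sup>2)) = b^4 * (2 * w)\<^sup>2"
    using assms(1) unfolding l a by algebra
  then have e: "(1 - t\<^sup>2) * (3 + t\<^sup>2) = (2 * w)\<^sup>2" using assms(2) by simp
  then have t: "t\<^sup>2 = 1" by (rule square_neg_quartic_rat)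
  then have "w = 0" using e by simp
  then show ?thesis using a t by (auto simp: power2_eq_1_iff)
qed

text \<open>The quadratic in \<open>a / b^2\<close> now has vertex
  \<open>-(3*g^2 + 8*g + 6)\<close>, and the shift \<open>2*g + 3\<close> makes the discriminant
  quartic even.\<close>

lemma halving_quartic_RQ:
  fixes a b l :: rat
  assumes "l^4 - 6*(2*b\<^sup>2 - a)*l\<^sup>2 - 8*(3*b^3 - 2*a*b)*l - 3*(2*b\<^sup>2-a)\<^sup>2 + 4*a\<^sup>2 = 0" "b \<noteq> 0"
  shows "a = - b\<^sup>2 \<or> a = - 2 * b\<^sup>2"
proof -
  define g where "g = l / b"
  define w where "w = a / b\<^sup>2 + 3*g\<^sup>2 + 8*g + 6"
  have l: "l = g * b" using assms(2) by (simp add: g_def)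
  have a: "a = (w - 3*g\<^sup>2 - 8*g - 6) * b\<^sup>2" using assms(2) by (simp add: w_def)
  have "b^4 * (2 * ((2*g+3)\<^sup>2 - 1) * ((2*g+3)\<^sup>2 + 3)) = b^4 * (2 * w)\<^sup>2"
    using assms(1) unfolding l a by algebra
  then have e: "2 * ((2*g+3)\<^sup>2 - 1) * ((2*g+3)\<^sup>2 + 3) = (2 * w)\<^sup>2" using assms(2) by simp
  then have h: "(2*g+3)\<^sup>2 = 1" by (rule square_double_quartic_rat)
  then have "w = 0" using e by simp
  moreover have "g = - 1 \<or> g = - 2" using h by (auto simp: power2_eq_1_iff)
  ultimately show ?thesis using a by auto
qed

section \<open>Estimates that exclude integral roots\<close>

text \<open>\<open>8*b^3 - l^3\<close> has the factor \<open>2*b - l\<close>, and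
  \<open>l*(2*b - l)\<close> is at least 1 at the integers strictly between 0 and
  \<open>2*b\<close>.\<close>

lemma bound_mult:
  fixes b l :: int
  assumes "1 \<le> l" "l \<le> 2*b - 1"
  shows "4 * b\<^sup>2 \<le> l * (8*b^3 - l^3)"
proof -
  have "0 \<le> (l - 1) * (2*b - 1 - l)" using assms by simp
  then have "1 \<le> l * (2*b - l)" using assms by (simp add: algebra_simps)
  moreover have "0 \<le> 2*b*l + l\<^sup>2" using assms by simp
  ultimately have "1 * (4*b\<^sup>2) \<le> (l * (2*b - l)) * (4*b\<^sup>2 + 2*b*l + l\<^sup>2)"
    by (intro mult_mono) auto
  also have "\<dots> = l * (8*b^3 - l^3)" by algebra
  finally show ?thesis by simp
qed

text \<open>The value is positive for \<open>l <= 0\<close> and \<open>l >= 2*b\<close>; at the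
  integers in between it is negative, as \<open>bound_mult\<close> outweighs
  \<open>4*a^2\<close>.\<close>

lemma halving_quartic_P:
  fixes a b l :: int
  assumes "0 < a" "a < b"
  shows "l^4 - 8*b^3*l + 4*a\<^sup>2 \<noteq> 0"
proof -
  have ab: "a\<^sup>2 < b\<^sup>2" using assms by (intro power_strict_mono) auto
  have a2: "0 < a\<^sup>2" using assms by simp
  consider "l \<le> 0" | "1 \<le> l" "l \<le> 2*b-1" | "2*b \<le> l" by linarith
  then show ?thesis
  proof cases
    case 1
    then have "b^3 * l \<le> 0" using assms by (intro mult_nonneg_nonpos) auto
    moreover have "0 \<le> l^4" by simp
    ultimately show ?thesis using a2 by linarith
  next
    case 2
    moreover have "l^4 - 8*b^3*l + 4*a\<^sup>2 = 4*a\<^sup>2 - l * (8*b^3 - l^3)" by algebra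
    ultimately show ?thesis using bound_mult[of l b] ab by linarith
  next
    case 3
    have "(2*b)^3 \<le> l^3" using 3 assms by (intro power_mono) auto
    then have "0 \<le> l * (l^3 - 8*b^3)" using 3 assms by simp
    moreover have "l^4 - 8*b^3*l + 4*a\<^sup>2 = 4*a\<^sup>2 + l * (l^3 - 8*b^3)" by algebra
    ultimately show ?thesis using a2 by linarith
  qed
qed

text \<open>The value is positive for \<open>l <= 0\<close> and \<open>l > 2*b\<close> and negative
  at the integers in between, including \<open>2*b\<close>.\<close>

lemma halving_quartic_Q:
  fixes a b l :: int
  assumes "0 < a" "a < b"
  shows "l^4 - 6*a*l\<^sup>2 - 8*b^3*l + a\<^sup>2 \<noteq> 0"
proof -
  have ab: "a\<^sup>2 < b\<^sup>2" using assms by (intro power_strict_mono) auto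
  have a2: "0 < a\<^sup>2" using assms by simp
  consider "l \<le> 0" | "1 \<le> l" "l \<le> 2*b-1" | "l = 2*b" | "2*b+1 \<le> l" by linarith
  then show ?thesis
  proof cases
    case 1
    define k where "k = - l"
    have k: "0 \<le> k" "l = - k" using 1 by (auto simp: k_def)
    \<comment> \<open>The tangent line of \<open>4*k^3\<close> at \<open>k = 3*b/2\<close>: a linear
      lower bound strong enough against \<open>6*a*k\<close>.\<close>
    have "0 \<le> (2*k - 3*b)\<^sup>2 * (k + 3*b)" using k assms by simp
    also have "\<dots> = 4*k^3 - 27*b\<^sup>2*k + 27*b^3" by algebra
    finally have s: "0 \<le> 4*k^3 - 27*b\<^sup>2*k + 27*b^3" .
    have "a * 1 \<le> b * b" using assms by (intro mult_mono) auto
    then have "a * k \<le> b\<^sup>2 * k" using k by (intro mult_right_mono) (auto simp: power2_eq_square)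
    moreover have "0 \<le> b\<^sup>2 * k" "0 < b^3" using k assms by auto
    ultimately have "0 \<le> k^3 + 8*b^3 - 6*a*k" using s by linarith
    then have "0 \<le> k * (k^3 + 8*b^3 - 6*a*k)" using k by simp
    moreover have "l^4 - 6*a*l\<^sup>2 - 8*b^3*l + a\<^sup>2 = a\<^sup>2 + k * (k^3 + 8*b^3 - 6*a*k)" unfolding k(2) by algebra
    ultimately show ?thesis using a2 by linarith
  next
    case 2
    have "0 \<le> 6*a*l\<^sup>2" using assms by simp
    moreover have "l^4 - 6*a*l\<^sup>2 - 8*b^3*l + a\<^sup>2 = a\<^sup>2 - 6*a*l\<^sup>2 - l * (8*b^3 - l^3)" by algebra
    moreover have "0 \<le> b\<^sup>2" by simp
    ultimately show ?thesis using bound_mult[OF 2] ab by linarith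
  next
    case 3
    have "a * 1 \<le> b * b" using assms by (intro mult_mono) auto
    then have "a * a \<le> a * (b * b)" using assms by (intro mult_left_mono) auto
    moreover have "0 < a * (b * b)" using assms by simp
    moreover have "l^4 - 6*a*l\<^sup>2 - 8*b^3*l + a\<^sup>2 = a * a - 24 * (a * (b * b))" unfolding 3 by algebra
    ultimately show ?thesis by linarith
  next
    case 4
    define e where "e = l - 2*b"
    have e: "1 \<le> e" "l = 2*b + e" using 4 by (auto simp: e_def)
    have "b * 1 \<le> b * e" using e assms by (intro mult_left_mono) auto
    then have be: "0 < b*e - a" using assms by linarith
    have "l^4 - 6*a*l\<^sup>2 - 8*b^3*l + a\<^sup>2 = l * (12*b*(b*e-a) + 6*e*(b*e-a) + e^3) + a\<^sup>2"
      unfolding e(2) by algebra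
    moreover have "0 \<le> 12*b*(b*e-a) + 6*e*(b*e-a) + e^3" using be e assms by simp
    then have "0 \<le> l * (12*b*(b*e-a) + 6*e*(b*e-a) + e^3)" using e assms by simp
    ultimately show ?thesis using a2 by linarith
  qed
qed

text \<open>The value is negative from 1 to \<open>2*b - 1\<close> and positive elsewhere. With
  \<open>d = 2*b - l\<close>, \<open>a^2\<close> minus the value is
  \<open>l*(d^3 + 6*l*(b*d - a))\<close>, which is at least \<open>b^2\<close>.\<close>

lemma halving_quartic_Q_neg:
  fixes a b l :: int
  assumes "0 < a" "a < b"
  shows "l^4 + 6*a*l\<^sup>2 - 8*b^3*l + a\<^sup>2 \<noteq> 0"
proof -
  have ab: "a\<^sup>2 < b\<^sup>2" using assms by (intro power_strict_mono) auto
  have a2: "0 < a\<^sup>2" using assms by simp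
  have al: "0 \<le> a * l\<^sup>2" using assms by simp
  consider "l \<le> 0" | "1 \<le> l" "l \<le> 2*b-1" | "2*b \<le> l" by linarith
  then show ?thesis
  proof cases
    case 1
    then have "b^3 * l \<le> 0" using assms by (intro mult_nonneg_nonpos) auto
    moreover have "0 \<le> l^4" by simp
    ultimately show ?thesis using a2 al by linarith
  next
    case 2
    define d where "d = 2*b - l"
    have d: "1 \<le> d" "l = 2*b - d" using 2 by (auto simp: d_def)
    have "0 \<le> a * (d - 1)" using d assms by simp
    moreover have "(a+1)*d \<le> b*d" using assms d by (intro mult_right_mono) auto
    ultimately have bd: "d \<le> b*d - a" by (simp add: algebra_simps)
    have "b\<^sup>2 \<le> l * (d^3 + 6*l*d)"
    \<comment> \<open>As \<open>l + d = 2*b\<close>, one of \<open>l\<close> and \<open>d\<close> is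
      at least \<open>b\<close>.\<close>
    proof (cases "b \<le> l")
      case True
      have "l * 1 \<le> l * d" using 2 d by (intro mult_left_mono) auto
      then have "b \<le> l * d" using True by linarith
      then have "b * b \<le> l * (l * d)" using True assms 2 by (intro mult_mono) auto
      moreover have "0 \<le> l * d^3" "0 \<le> l * (l * d)" using 2 d by simp_all
      moreover have "l * (d^3 + 6*l*d) = l * d^3 + 6 * (l * (l * d))" by algebra
      ultimately show ?thesis by (simp add: power2_eq_square)
    next
      case False
      then have "b \<le> d" using d by linarith
      then have "b\<^sup>2 \<le> d\<^sup>2" using assms by (intro power_mono) auto
      also have "\<dots> \<le> d^3" using d by (intro power_increasing) auto
      also have "\<dots> \<le> l * d^3" using 2 d by (simp add: mult_le_cancel_right1)
      also have "\<dots> \<le> l * (d^3 + 6*l*d)" using 2 d by (intro mult_left_mono) auto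
      finally show ?thesis .
    qed
    also have "\<dots> \<le> l * (d^3 + 6*l*(b*d - a))" using bd 2 by (intro mult_left_mono add_left_mono) auto
    also have "\<dots> = a\<^sup>2 - (l^4 + 6*a*l\<^sup>2 - 8*b^3*l + a\<^sup>2)" unfolding d(2) by algebra
    finally show ?thesis using ab by linarith
  next
    case 3
    have "(2*b)^3 \<le> l^3" using 3 assms by (intro power_mono) auto
    then have "0 \<le> l * (l^3 - 8*b^3)" using 3 assms by simp
    moreover have "l^4 + 6*a*l\<^sup>2 - 8*b^3*l + a\<^sup>2 = a\<^sup>2 + 6*(a*l\<^sup>2) + l * (l^3 - 8*b^3)" by algebra
    ultimately show ?thesis using a2 al by linarith
  qed
qed

text \<open>The cubic is positive at integers from \<open>- b^2\<close> upwards and negative from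
  \<open>- b^2 - 1\<close> downwards: its real root lies between consecutive integers.\<close>

lemma cubic_no_root:
  fixes a b x :: int
  assumes "0 < a" "a < b"
  shows "x^3 - a\<^sup>2 * x + b^6 \<noteq> 0"
proof -
  have ab: "a\<^sup>2 < b\<^sup>2" using assms by (intro power_strict_mono) auto
  have a3: "a^3 < b^6"
  proof -
    have "a^3 < b^3" using assms by (intro power_strict_mono) auto
    also have "\<dots> \<le> b^6" using assms by (intro power_increasing) auto
    finally show ?thesis .
  qed
  have b6: "0 < b^6" using assms by simp
  consider "a \<le> \<bar>x\<bar>" "0 \<le> x" | "\<bar>x\<bar> < a" | "a \<le> - x" "- x \<le> b\<^sup>2" | "b\<^sup>2 + 1 \<le> - x" by linarith
  then show ?thesis
  proof cases
    case 1
    then have "a\<^sup>2 \<le> x\<^sup>2" using assms by (intro power_mono) auto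
    then have "a\<^sup>2 * x \<le> x\<^sup>2 * x" using 1 by (intro mult_right_mono) auto
    also have "\<dots> = x^3" by algebra
    finally show ?thesis using b6 by linarith
  next
    case 2
    have "\<bar>x\<^sup>2 - a\<^sup>2\<bar> \<le> a\<^sup>2"
    proof -
      have "x\<^sup>2 \<le> a\<^sup>2" using 2 by (metis abs_le_square_iff abs_of_pos assms(1) less_imp_le)
      then show ?thesis by simp
    qed
    then have "\<bar>x\<bar> * \<bar>x\<^sup>2 - a\<^sup>2\<bar> \<le> a * a\<^sup>2" using 2 by (intro mult_mono) auto
    then have "\<bar>x^3 - a\<^sup>2 * x\<bar> \<le> a^3"
      unfolding abs_mult[symmetric] by (simp add: algebra_simps power2_eq_square power3_eq_cube)
    then show ?thesis using a3 by linarith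
  next
    case 3
    define r where "r = - x"
    have r: "0 < r" "r \<le> b\<^sup>2" "x = - r" using 3 assms by (auto simp: r_def)
    have "r^3 \<le> (b\<^sup>2)^3" using r by (intro power_mono) auto
    moreover have "0 < a\<^sup>2 * r" using r assms by simp
    ultimately show ?thesis using r(3) by simp
  next
    case 4
    define r where "r = - x"
    have r: "b\<^sup>2 + 1 \<le> r" "x = - r" using 4 by (auto simp: r_def)
    have b2: "0 \<le> b\<^sup>2" by simp
    have "(b\<^sup>2+1)\<^sup>2 \<le> r\<^sup>2" using r(1) b2 by (intro power_mono) auto
    then have "(b\<^sup>2 + 1) * ((b\<^sup>2+1)\<^sup>2 - b\<^sup>2) \<le> r * (r\<^sup>2 - a\<^sup>2)"
    proof (intro mult_mono)
      have "(b\<^sup>2+1)\<^sup>2 - b\<^sup>2 = (b\<^sup>2)\<^sup>2 + b\<^sup>2 + 1" by algebra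
      then show "0 \<le> (b\<^sup>2+1)\<^sup>2 - b\<^sup>2" by simp
    qed (use r(1) b2 ab in linarith)+
    moreover have "(b\<^sup>2 + 1) * ((b\<^sup>2+1)\<^sup>2 - b\<^sup>2) = b^6 + 2 * b^4 + 2 * b\<^sup>2 + 1" by algebra
    moreover have "0 \<le> b^4" by simp
    ultimately have "b^6 < r * (r\<^sup>2 - a\<^sup>2)" using b2 by linarith
    then show ?thesis unfolding r(2) by (simp add: algebra_simps power2_eq_square power3_eq_cube)
  qed
qed

section \<open>The 2-adic filtration\<close>

text \<open>Membership replaces 2-adic valuations: \<open>x / 2^n\<close> lies in
  \<open>Zloc2\<close> when \<open>x\<close> has valuation at least \<open>n\<close>.\<close>

definition Zloc2 :: "rat set" where
  "Zloc2 = {r. \<exists>p q :: int. odd q \<and> r = of_int p / of_int q}"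

lemma Zloc2_of_int [simp]: "of_int n \<in> Zloc2"
  unfolding Zloc2_def by (intro CollectI exI[of _ n] exI[of _ 1]) simp

lemma Zloc2_numeral [simp]: "numeral n \<in> Zloc2" "1 \<in> Zloc2"
  using Zloc2_of_int[of "numeral n"] Zloc2_of_int[of 1] by simp_all

lemma Zloc2_add [simp]:
  assumes "x \<in> Zloc2" "y \<in> Zloc2" shows "x + y \<in> Zloc2"
proof -
  obtain p q p' q' :: int where "odd q" "x = of_int p / of_int q" "odd q'" "y = of_int p' / of_int q'"
    using assms unfolding Zloc2_def by blast
  moreover from this have "q \<noteq> 0" "q' \<noteq> 0" by auto
  ultimately show ?thesis unfolding Zloc2_def
    by (intro CollectI exI[of _ "p * q' + p' * q"] exI[of _ "q * q'"]) (simp add: field_simps)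
qed

lemma Zloc2_mult [simp]:
  assumes "x \<in> Zloc2" "y \<in> Zloc2" shows "x * y \<in> Zloc2"
proof -
  obtain p q p' q' :: int where "odd q" "x = of_int p / of_int q" "odd q'" "y = of_int p' / of_int q'"
    using assms unfolding Zloc2_def by blast
  then show ?thesis unfolding Zloc2_def
    by (intro CollectI exI[of _ "p * p'"] exI[of _ "q * q'"]) simp
qed

lemma Zloc2_minus [simp]: "x \<in> Zloc2 \<Longrightarrow> - x \<in> Zloc2"
  using Zloc2_mult[of "-1" x] Zloc2_of_int[of "-1"] by simp

lemma Zloc2_diff [simp]: "x \<in> Zloc2 \<Longrightarrow> y \<in> Zloc2 \<Longrightarrow> x - y \<in> Zloc2"
  using Zloc2_add[of x "-y"] by simp

lemma Zloc2_power [simp]: "x \<in> Zloc2 \<Longrightarrow> x ^ n \<in> Zloc2"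
  by (induction n) simp_all

lemma Zloc2_half: "1 / 2 \<notin> Zloc2"
proof
  assume "1 / 2 \<in> Zloc2"
  then obtain p q :: int where pq: "odd q" "1 / 2 = (of_int p / of_int q :: rat)" unfolding Zloc2_def by blast
  then have "(of_int q :: rat) = of_int (2 * p)" by (auto simp: field_simps)
  then show False using pq(1) by (simp only: of_int_eq_iff) simp
qed

lemma Zloc2_unit:
  assumes "x \<in> Zloc2" shows "1 + 2 * x \<noteq> 0"
proof
  assume "1 + 2 * x = 0"
  then have "1 / 2 = - x" by simp
  then show False using Zloc2_half Zloc2_minus[OF assms] by metis
qed

text \<open>\<open>1 + 2*x\<close> is a unit, since its numerator \<open>q + 2*p\<close> is odd.
  Denominators below are brought into this shape.\<close>

lemma Zloc2_divide:
  assumes "x \<in> Zloc2" "y \<in> Zloc2" shows "y / (1 + 2 * x) \<in> Zloc2"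
proof -
  obtain p q :: int where pq: "odd q" "x = of_int p / of_int q"
    using assms(1) unfolding Zloc2_def by blast
  have "q \<noteq> 0" using pq by auto
  have "of_int (q + 2 * p) = of_int q * (1 + 2 * x)"
    using \<open>q \<noteq> 0\<close> pq(2) by (simp add: field_simps)
  then have "1 / (1 + 2 * x) = of_int q / of_int (q + 2 * p)" using \<open>q \<noteq> 0\<close> by simp
  moreover have "odd (q + 2 * p)" using pq(1) by simp
  ultimately have "1 / (1 + 2 * x) \<in> Zloc2" unfolding Zloc2_def by blast
  then have "y * (1 / (1 + 2 * x)) \<in> Zloc2" using assms(2) by (rule Zloc2_mult[rotated])
  then show ?thesis by simp
qed

text \<open>With \<open>z = x/y\<close> and \<open>w = 1/y\<close> the curve is
  \<open>w = z^3 + A*z*w^2 + B*w^3\<close>. Subtracting the equations of two points and dividing by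
  \<open>z2 - z1\<close> gives the slope in these coordinates; cleared of denominators the formula
  also covers tangents.\<close>

lemma coll_slope_identity:
  assumes "coll A B l m x1 x2 x3" "y1 = l*x1+m" "y2 = l*x2+m"
  shows "l * (y1^2*y2^2 - A*x2*y1*(y1+y2) - B*(y1^2+y1*y2+y2^2)) =
    - m * (x1^2*y2^2 + x1*x2*y1*y2 + x2^2*y1^2 + A*y2^2)"
proof -
  have "x3 = l^2 - x1 - x2" "A = 2*l*m + x1*x2 + x1*x3 + x2*x3" "B = m^2 - x1*x2*x3"
    using assms(1) by (simp_all add: coll_def algebra_simps)
  then show ?thesis using assms(2,3) by algebra
qed

text \<open>In the coordinates \<open>z = x/y\<close>, \<open>w = 1/y\<close> the line becomes \<open>w = lam z + nu\<close>, and \<open>lam\<close> can be written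
  with a denominator that is a 2-adic unit even if the points coincide 2-adically.\<close>

lemma coll_kernel_of_reduction:
  assumes c: "coll (2*A) (2*B) l m x1 x2 x3"
    and y: "y1 = l*x1+m" "y2 = l*x2+m" "y3 = l*x3+m" and y0: "y1 \<noteq> 0" "y2 \<noteq> 0"
    and AB: "A \<in> Zloc2" "B \<in> Zloc2"
    and zw: "x1/y1 \<in> Zloc2" "1/y1 \<in> Zloc2" "x2/y2 \<in> Zloc2" "1/y2 \<in> Zloc2"
  shows "y3 \<noteq> 0 \<and> x3/y3 \<in> Zloc2 \<and> 1/y3 \<in> Zloc2"
proof -
  define z1 w1 z2 w2 where zw_def: "z1 = x1/y1" "w1 = 1/y1" "z2 = x2/y2" "w2 = 1/y2"
  have O: "z1 \<in> Zloc2" "w1 \<in> Zloc2" "z2 \<in> Zloc2" "w2 \<in> Zloc2" using zw by (simp_all add: zw_def)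
  \<comment> \<open>\<open>coll_slope_identity\<close> divided by \<open>y1^2*y2^2\<close> says that
    \<open>lam = e / (1 + 2*d)\<close>; the even coefficients \<open>2*A\<close> and
    \<open>2*B\<close> make this denominator a unit.\<close>
  define d where "d = - (A*z2*(w1+w2) + B*(w1^2+w1*w2+w2^2))"
  have dO: "d \<in> Zloc2" unfolding d_def using O AB by simp
  define e where "e = z1^2 + z1*z2 + z2^2 + 2*A*w1^2"
  have eO: "e \<in> Zloc2" unfolding e_def using O AB by simp
  have yy: "y1 * w1 = 1" "y2 * w2 = 1" "z1 = x1 * w1" "z2 = x2 * w2" using y0 by (simp_all add: zw_def)
  have slope: "l * (1 + 2*d) = - m * e"
    using coll_slope_identity[OF c y(1,2)] yy unfolding d_def e_def by algebra
  have d0: "1 + 2*d \<noteq> 0" by (rule Zloc2_unit[OF dO])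
  have m0: "m \<noteq> 0"
  proof
    assume "m = 0"
    then have "l = 0" using slope d0 by simp
    then show False using \<open>m = 0\<close> y y0 by simp
  qed
  define lam where "lam = - l / m"
  have LO: "lam \<in> Zloc2"
  proof -
    have "lam = e / (1 + 2*d)" using slope d0 m0 by (simp add: lam_def field_simps)
    then show ?thesis using Zloc2_divide[OF dO eO] by simp
  qed
  define nu where "nu = 1 / m"
  have mN: "m * nu = 1" "l = - lam * m" using m0 by (simp_all add: nu_def lam_def)
  have "nu = w1 - lam * z1" using mN y(1) yy by algebra
  then have NO: "nu \<in> Zloc2" using LO O by simp
  \<comment> \<open>\<open>1 + 2*f\<close> is the leading coefficient of the cubic in
    \<open>z\<close> obtained by inserting \<open>w = lam*z + nu\<close>; Vieta's formula for that
    cubic gives \<open>z1 + z2 + z3\<close> below.\<close>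
  define f where "f = A*lam^2 + B*lam^3"
  have fO: "f \<in> Zloc2" unfolding f_def using LO AB by simp
  have f0: "1 + 2*f \<noteq> 0" by (rule Zloc2_unit[OF fO])
  have cc: "l^2 = x1+x2+x3" "2*A - 2*l*m = x1*x2+x1*x3+x2*x3" "m^2 - 2*B = x1*x2*x3"
    using c by (simp_all add: coll_def)
  have prod: "y1*y2*y3 = m^3 * (1 + 2*f)"
  proof -
    have "y1*y2*y3 = l^3*(x1*x2*x3) + l^2*m*(x1*x2+x1*x3+x2*x3) + l*m^2*(x1+x2+x3) + m^3"
      unfolding y by algebra
    also have "\<dots> = m^3 + 2*A*l^2*m - 2*B*l^3" using cc by algebra
    also have "\<dots> = m^3 * (1 + 2*f)" unfolding f_def mN(2) by algebra
    finally show ?thesis .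
  qed
  have y30: "y3 \<noteq> 0" using prod m0 f0 by auto
  define z3 where "z3 = x3 / y3"
  have "x1*y2*y3 + x2*y1*y3 + x3*y1*y2 = 4*A*l*m - 6*B*l^2"
    using cc unfolding y by algebra
  moreover have "4*A*l*m - 6*B*l^2 = - (m^3 * (nu * (4*A*lam + 6*B*lam^2)))" using mN by algebra
  ultimately have s: "x1*y2*y3 + x2*y1*y3 + x3*y1*y2 = - (m^3 * (nu * (4*A*lam + 6*B*lam^2)))" by simp
  have "z1 + z2 + z3 = (x1*y2*y3 + x2*y1*y3 + x3*y1*y2) / (y1*y2*y3)"
    using y0 y30 by (simp add: zw_def z3_def field_simps)
  also have "\<dots> = - (nu * (4*A*lam + 6*B*lam^2) / (1 + 2*f))"
    unfolding s prod using m0 by simp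
  finally have "z3 = - z1 - z2 - nu * (4*A*lam + 6*B*lam^2) / (1 + 2*f)" by simp
  moreover have "nu * (4*A*lam + 6*B*lam^2) / (1 + 2*f) \<in> Zloc2"
    by (rule Zloc2_divide[OF fO]) (use NO LO AB in simp)
  ultimately have z3O: "z3 \<in> Zloc2" using O by simp
  have "y3 * z3 = x3" using y30 by (simp add: z3_def)
  moreover have "l * nu = - lam" using mN by simp
  then have "y3 * nu = 1 - lam * x3" unfolding y(3) using mN(1) by algebra
  moreover have "y3 * (lam * z3 + nu) = lam * (y3 * z3) + y3 * nu" by (simp add: algebra_simps)
  ultimately have "y3 * (lam * z3 + nu) = 1" by simp
  then have "1 / y3 = lam * z3 + nu" using y30 by (metis nonzero_mult_div_cancel_left)
  then have "1/y3 \<in> Zloc2" using LO NO z3O by simp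
  then show ?thesis using y30 z3O by (simp add: z3_def)
qed

text \<open>For \<open>t = 2\<^sup>n\<close> and integral \<open>A\<close>, \<open>B\<close> this is the \<open>n\<close>-th step of the 2-adic filtration.\<close>

definition ker_red :: "rat \<Rightarrow> rat \<Rightarrow> rat \<Rightarrow> ec_point set" where
  "ker_red A B t = {P. on_curve A B P \<and>
     (case P of Inf \<Rightarrow> True | Pt x y \<Rightarrow> y \<noteq> 0 \<and> x / (y * t) \<in> Zloc2 \<and> 1 / (y * t^3) \<in> Zloc2)}"

text \<open>Scaling \<open>(x, y)\<close> to \<open>(x*t^2, y*t^3)\<close> leads to the coefficients
  \<open>A*t^4\<close> and \<open>B*t^6\<close>, twice elements of \<open>Zloc2\<close>. Modulo 2
  the scaled curve is \<open>y^2 = x^3\<close>, and the subgroup consists of the points that do not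
  reduce to the cusp.\<close>

lemma ker_red_subgroup:
  assumes ns: "nonsingular A B" and t: "t \<noteq> 0"
    and AB: "A * t^4 / 2 \<in> Zloc2" "B * t^6 / 2 \<in> Zloc2"
  shows "subgroup (ker_red A B t) (ec_group A B)"
proof -
  interpret comm_group "ec_group A B" by (rule comm_group_ec_group[OF ns])
  have scale: "x / (y * t) = (x * t^2) / (y * t^3)" for x y using t by (simp add: power2_eq_square power3_eq_cube)
  show ?thesis
  proof (rule subgroupI)
    show "ker_red A B t \<subseteq> carrier (ec_group A B)" by (auto simp: ker_red_def)
    show "ker_red A B t \<noteq> {}" by (auto simp: ker_red_def on_curve_def intro: exI[of _ Inf])
    show "inv\<^bsub>ec_group A B\<^esub> P \<in> ker_red A B t" if "P \<in> ker_red A B t" for P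
    proof -
      have "on_curve A B P" using that by (simp add: ker_red_def)
      then show ?thesis using that ec_group_inv[OF ns, of P] on_curve_neg[of A B P]
        by (cases P) (auto simp: ker_red_def)
    qed
    show "P \<otimes>\<^bsub>ec_group A B\<^esub> Q \<in> ker_red A B t" if P: "P \<in> ker_red A B t" and Q: "Q \<in> ker_red A B t" for P Q
    proof (cases P; cases Q)
      fix x1 y1 x2 y2 assume pq: "P = Pt x1 y1" "Q = Pt x2 y2"
      have c: "on_curve A B (Pt x1 y1)" "on_curve A B (Pt x2 y2)" using P Q pq by (auto simp: ker_red_def)
      have sum: "on_curve A B (ec_add A B P Q)" using c on_curve_add[OF _ _ ns] unfolding pq by blast
      from c show ?thesis
      proof (cases rule: ec_add_cases)
        case 1
        then show ?thesis by (simp add: pq ker_red_def on_curve_def)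
      next
        case (2 l m x3)
        define y3 where "y3 = l*x3+m"
        have S: "ec_add A B P Q = Pt x3 (- y3)"
          using ec_add_coll[OF ns 2(1)] 2 pq by (simp add: y3_def)
        have "coll (2*(A*t^4/2)) (2*(B*t^6/2)) (l*t) (m*t^3) (x1*t^2) (x2*t^2) (x3*t^2)"
          using 2(1) unfolding coll_def by simp algebra
        then have "y3 * t^3 \<noteq> 0 \<and> x3*t^2/(y3 * t^3) \<in> Zloc2 \<and> 1/(y3 * t^3) \<in> Zloc2"
        proof (rule coll_kernel_of_reduction[where ?y1.0 = "y1 * t^3" and ?y2.0 = "y2 * t^3"])
          show "y1 * t^3 = l*t*(x1*t^2) + m*t^3" using 2(2) by algebra
          show "y2 * t^3 = l*t*(x2*t^2) + m*t^3" using 2(3) by algebra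
          show "y3 * t^3 = l*t*(x3*t^2) + m*t^3" unfolding y3_def by algebra
        qed (use P Q pq t AB scale in \<open>auto simp: ker_red_def\<close>)
        then show ?thesis using sum S scale by (auto simp: ker_red_def)
      qed
    qed (use P Q in auto)
  qed
qed

section \<open>Relations modulo 2\<close>

text \<open>In the square of the relation, with \<open>c3 = 2*j + 1\<close>, everything except one
  factor \<open>g3 \<otimes> g3\<close> lies in \<open>H\<close>.\<close>

lemma (in comm_group) odd_exponent_in_subgroup:
  fixes c1 c2 c3 :: int
  assumes H: "subgroup H G" and g: "g1 \<in> carrier G" "g2 \<in> carrier G" "g3 \<in> carrier G"
    and h: "g1 \<otimes> g1 \<in> H" "g2 \<otimes> g2 \<in> H" "(g3 \<otimes> g3) \<otimes> (g3 \<otimes> g3) \<in> H"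
    and rel: "g1 [^] c1 \<otimes> (g2 [^] c2 \<otimes> g3 [^] c3) = \<one>" and odd: "odd c3"
  shows "g3 \<otimes> g3 \<in> H"
proof -
  interpret H: subgroup H G by fact
  obtain j where j: "c3 = 2 * j + 1" using odd by (rule oddE)
  define k where "k = g3 \<otimes> g3"
  have k: "k \<in> carrier G" using g by (simp add: k_def)
  define A where "A = (g1 \<otimes> g1) [^] c1 \<otimes> ((g2 \<otimes> g2) [^] c2 \<otimes> (k \<otimes> k) [^] j)"
  have "A \<in> H"
    unfolding A_def using h by (auto simp: k_def intro!: H.m_closed subgroup_int_pow_closed[OF H])
  have "(g1 [^] c1 \<otimes> (g2 [^] c2 \<otimes> g3 [^] c3)) \<otimes> (g1 [^] c1 \<otimes> (g2 [^] c2 \<otimes> g3 [^] c3)) =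
     (g1 \<otimes> g1) [^] c1 \<otimes> ((g2 \<otimes> g2) [^] c2 \<otimes> k [^] c3)"
    unfolding k_def using g by (simp add: int_pow_distrib m_ac)
  also have "k [^] c3 = (k \<otimes> k) [^] j \<otimes> k"
    unfolding j mult_2 using k by (simp only: int_pow_mult int_pow_distrib int_pow_closed int_pow_1)
  finally have "A \<otimes> k = \<one>" using g k rel by (simp add: A_def m_ac)
  then have "k = inv A" using \<open>A \<in> H\<close> H.mem_carrier k by (metis inv_equality m_comm)
  then show ?thesis using \<open>A \<in> H\<close> H.m_inv_closed by (simp add: k_def)
qed

text \<open>Exponents may be changed within their parity at the cost of a square, so a relation
  makes a product with small exponents a square.\<close>

lemma (in comm_group) relation_mod_2:
  fixes c1 c2 c3 e1 e2 e3 :: int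
  assumes g: "g1 \<in> carrier G" "g2 \<in> carrier G" "g3 \<in> carrier G"
    and rel: "g1 [^] c1 \<otimes> (g2 [^] c2 \<otimes> g3 [^] c3) = \<one>"
    and e: "even (e1 - c1)" "even (e2 - c2)" "even (e3 - c3)"
  obtains s where "s \<in> carrier G" "g1 [^] e1 \<otimes> (g2 [^] e2 \<otimes> g3 [^] e3) = s \<otimes> s"
proof -
  obtain j1 j2 j3 where j: "e1 - c1 = 2*j1" "e2 - c2 = 2*j2" "e3 - c3 = 2*j3" using e by (meson evenE)
  then have j': "e1 = c1 + j1 + j1" "e2 = c2 + j2 + j2" "e3 = c3 + j3 + j3" by simp_all
  define s where "s = g1 [^] j1 \<otimes> (g2 [^] j2 \<otimes> g3 [^] j3)"
  have dbl: "g [^] (c + j + j) = g [^] c \<otimes> (g [^] j \<otimes> g [^] j)" if "g \<in> carrier G" for g and c j :: int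
    using that by (simp only: int_pow_mult int_pow_closed m_assoc)
  have "g1 [^] e1 \<otimes> (g2 [^] e2 \<otimes> g3 [^] e3) =
     (g1 [^] c1 \<otimes> (g2 [^] c2 \<otimes> g3 [^] c3)) \<otimes> (s \<otimes> s)"
    unfolding j' s_def using g by (simp only: dbl) (simp add: m_ac)
  then show thesis using that[of s] rel g by (simp add: s_def)
qed

text \<open>Descent on the exponents: half of a relation is an element with trivial square, hence
  again a relation.\<close>

lemma (in comm_group) independent_if_relations_even:
  fixes c1 c2 c3 :: int
  assumes g: "g1 \<in> carrier G" "g2 \<in> carrier G" "g3 \<in> carrier G"
    and even: "\<And>(c1::int) (c2::int) (c3::int). g1 [^] c1 \<otimes> (g2 [^] c2 \<otimes> g3 [^] c3) = \<one> \<Longrightarrow> even c1 \<and> even c2 \<and> even c3"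
    and tors: "\<And>s. s \<in> carrier G \<Longrightarrow> s \<otimes> s = \<one> \<Longrightarrow> s = \<one>"
    and rel: "g1 [^] c1 \<otimes> (g2 [^] c2 \<otimes> g3 [^] c3) = \<one>"
  shows "c1 = 0 \<and> c2 = 0 \<and> c3 = 0"
  using rel
proof (induction "nat (\<bar>c1\<bar> + \<bar>c2\<bar> + \<bar>c3\<bar>)" arbitrary: c1 c2 c3 rule: less_induct)
  case less
  obtain j1 j2 j3 where j: "c1 = 2*j1" "c2 = 2*j2" "c3 = 2*j3" using even[OF less.prems] by (auto elim!: evenE)
  then have j': "c1 = j1 + j1" "c2 = j2 + j2" "c3 = j3 + j3" by simp_all
  define s where "s = g1 [^] j1 \<otimes> (g2 [^] j2 \<otimes> g3 [^] j3)"
  have s: "s \<in> carrier G" using g by (simp add: s_def)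
  have "s \<otimes> s = g1 [^] c1 \<otimes> (g2 [^] c2 \<otimes> g3 [^] c3)"
    unfolding j' s_def using g by (simp only: int_pow_mult) (simp add: m_ac)
  then have "s = \<one>" using less.prems tors[OF s] by simp
  then have hyp: "j1 = 0 \<and> j2 = 0 \<and> j3 = 0" if "nat (\<bar>j1\<bar> + \<bar>j2\<bar> + \<bar>j3\<bar>) < nat (\<bar>c1\<bar> + \<bar>c2\<bar> + \<bar>c3\<bar>)"
    using less.hyps[of j1 j2 j3] that by (simp add: s_def)
  show ?case
  proof (cases "c1 = 0 \<and> c2 = 0 \<and> c3 = 0")
    case False
    then have "nat (\<bar>j1\<bar> + \<bar>j2\<bar> + \<bar>j3\<bar>) < nat (\<bar>c1\<bar> + \<bar>c2\<bar> + \<bar>c3\<bar>)" using j by linarith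
    then show ?thesis using hyp j by simp
  qed
qed

section \<open>Half points and tangent slopes\<close>

text \<open>The tangent at \<open>S\<close> has \<open>2*x1 = l^2 - x\<close> and
  \<open>m = - y - l*x\<close>; eliminating \<open>x1\<close> and \<open>m\<close> from the
  coefficient equation for \<open>A\<close> leaves a quartic in \<open>l\<close>.\<close>

lemma halving_quartic:
  assumes "nonsingular A B" "on_curve A B S" "ec_add A B S S = Pt x y"
  obtains l where "l^4 - 6*x*l\<^sup>2 - 8*y*l - 3*x\<^sup>2 - 4*A = 0"
proof -
  obtain x1 y1 where S: "S = Pt x1 y1" using assms(3) by (cases S) auto
  have c: "on_curve A B (Pt x1 y1)" using assms S by simp
  from c c show thesis
  proof (cases rule: ec_add_cases)
    case 1
    then show ?thesis using assms(3) S by simp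
  next
    case (2 l m x3)
    have "x = x3" "y = -(l*x3+m)" using ec_add_coll[OF assms(1) 2(1)] 2 assms(3) S by auto
    moreover have "2*x1 = l\<^sup>2 - x3" "4*A = 8*l*m + (2*x1)\<^sup>2 + 4*(2*x1)*x3"
      using 2(1) by (simp_all add: coll_def power2_eq_square algebra_simps)
    then have "4*A = 8*l*m + (l\<^sup>2 - x3)\<^sup>2 + 4*(l\<^sup>2 - x3)*x3" by simp
    ultimately have "m = - y - l*x" "4*A = 8*l*m + (l\<^sup>2 - x)\<^sup>2 + 4*(l\<^sup>2 - x)*x" by simp_all
    then have "l^4 - 6*x*l\<^sup>2 - 8*y*l - 3*x\<^sup>2 - 4*A = 0" by algebra
    then show ?thesis by (rule that)
  qed
qed

text \<open>Here \<open>k\<close> parametrises the rational curve of all \<open>\<beta> = b\<^sup>2/a\<close> for which \<open>Q\<^sub>1 + Q\<^sub>2 + R\<close> is a double.\<close>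

lemma halving_quartic_RP:
  fixes \<beta> k :: rat
  assumes "\<beta> * (k^4 + 4*k^3 - 6*k\<^sup>2 + 4*k + 1) = - 4 * k * (k\<^sup>2 - 1)"
  shows "\<beta> / 8 \<in> Zloc2"
proof -
  obtain p q where pq: "k = of_int p / of_int q" "q \<noteq> 0" "coprime p q" by (rule rat_coprime_fraction)
  define Q P where "Q = (of_int q :: rat)" and "P = (of_int p :: rat)"
  have kQ: "k * Q = P" "Q \<noteq> 0" using pq by (simp_all add: Q_def P_def)
  \<comment> \<open>The quartic in \<open>k\<close> is \<open>(k + 1)^4 - 12*k^2\<close>.\<close>
  have e: "\<beta> * ((P + Q)^4 - 12*P\<^sup>2*Q\<^sup>2) = - 4 * (P*Q*(P\<^sup>2 - Q\<^sup>2))"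
    using assms unfolding kQ(1)[symmetric] by algebra
  have *: "\<beta> / 8 \<in> Zloc2" if "\<beta> * of_int n = 8 * of_int j" "odd n" for n j
  proof -
    have "n \<noteq> 0" using that by auto
    then have "\<beta> / 8 = of_int j / of_int n" using that(1) by (simp add: field_simps)
    then show ?thesis using that(2) unfolding Zloc2_def by blast
  qed
  show ?thesis
  \<comment> \<open>If \<open>p + q\<close> is odd, so is the factor of \<open>\<beta>\<close>, and
    the even \<open>p*q\<close> completes the 8 on the right. If \<open>p\<close> and
    \<open>q\<close> are odd, a 4 cancels and \<open>p^2 - q^2\<close> supplies the 8.\<close>
  proof (cases "even (p + q)")
    case False
    then have "even (p * q)" by auto
    then obtain i where i: "p * q = 2 * i" by blast
    have "P * Q = 2 * of_int i" using arg_cong[OF i, of "of_int :: int \<Rightarrow> rat"] by (simp add: P_def Q_def)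
    then have "\<beta> * ((P + Q)^4 - 12*P\<^sup>2*Q\<^sup>2) = 8 * (- of_int i * (P\<^sup>2 - Q\<^sup>2))" using e by simp
    then have "\<beta> * of_int ((p + q)^4 - 12*p\<^sup>2*q\<^sup>2) = 8 * of_int (- i * (p\<^sup>2 - q\<^sup>2))"
      by (simp add: P_def Q_def)
    then show ?thesis by (rule *) (use False in simp)
  next
    case True
    then have odd: "odd p" "odd q" using pq(3) by (metis coprime_common_divisor even_add odd_one)+
    then have "p\<^sup>2 mod 8 = 1" "q\<^sup>2 mod 8 = 1" by (simp_all add: odd_square_mod8)
    then have "8 dvd p\<^sup>2 - q\<^sup>2" by presburger
    then obtain i where i: "p\<^sup>2 - q\<^sup>2 = 8 * i" by blast
    obtain j where j: "p + q = 2 * j" using True by blast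
    have i': "P\<^sup>2 - Q\<^sup>2 = 8 * of_int i" using arg_cong[OF i, of "of_int :: int \<Rightarrow> rat"] by (simp add: P_def Q_def)
    have j': "P + Q = 2 * of_int j" using arg_cong[OF j, of "of_int :: int \<Rightarrow> rat"] by (simp add: P_def Q_def)
    have "\<beta> * (4 * (of_int j)^4 - 3*P\<^sup>2*Q\<^sup>2) * 4 = (8 * (- P * Q * of_int i)) * 4"
      using e unfolding i' j' by algebra
    then have "\<beta> * (4 * (of_int j)^4 - 3*P\<^sup>2*Q\<^sup>2) = 8 * (- P * Q * of_int i)" by simp
    then have "\<beta> * of_int (4 * j^4 - 3*p\<^sup>2*q\<^sup>2) = 8 * of_int (- p * q * i)" by (simp add: P_def Q_def)
    then show ?thesis by (rule *) (use odd in simp)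
  qed
qed

section \<open>Three independent points\<close>

locale two_parameter_curve =
  fixes a b :: int
  assumes a_pos: "0 < a" and a_less_b: "a < b"
begin

definition \<a> :: rat where "\<a> = of_int a"
definition \<b> :: rat where "\<b> = of_int b"
abbreviation A :: rat where "A \<equiv> - (\<a>\<^sup>2)"
abbreviation B :: rat where "B \<equiv> \<b>^6"
abbreviation E where "E \<equiv> ec_group A B"
abbreviation Q1 where "Q1 \<equiv> Pt \<a> (\<b>^3)"
abbreviation Q2 where "Q2 \<equiv> Pt (- \<a>) (\<b>^3)"
abbreviation R where "R \<equiv> Pt (- (\<b>\<^sup>2)) (\<a> * \<b>)"

lemma a0: "0 < \<a>" and b0: "0 < \<b>" and ab: "\<a> < \<b>" and b1: "1 < \<b>"
  using a_pos a_less_b by (simp_all add: \<a>_def \<b>_def)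

lemma a_less_b2: "\<a> < \<b>\<^sup>2"
proof -
  have "\<b> * 1 \<le> \<b> * \<b>" using b0 b1 by (intro mult_left_mono) auto
  then show ?thesis using ab by (simp add: power2_eq_square)
qed

lemma nonsing: "nonsingular A B"
proof -
  have "\<a>^6 < \<b>^6" using a0 ab by (intro power_strict_mono) auto
  also have "\<dots> \<le> \<b>^12" using b1 by (intro power_increasing) auto
  finally have "\<a>^6 < \<b>^12" .
  moreover have "0 < \<b>^12" using b0 by simp
  moreover have "4 * A^3 + 27 * B\<^sup>2 = 27 * \<b>^12 - 4 * \<a>^6" by algebra
  ultimately show ?thesis unfolding nonsingular_def by linarith
qed

sublocale comm_group E by (rule comm_group_ec_group[OF nonsing])

lemma on_curve_points: "on_curve A B Q1" "on_curve A B Q2" "on_curve A B R"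
  unfolding on_curve_def ec_point.case by algebra+

lemma no_two_torsion:
  assumes "S \<in> carrier E" "S \<otimes>\<^bsub>E\<^esub> S = \<one>\<^bsub>E\<^esub>"
  shows "S = \<one>\<^bsub>E\<^esub>"
proof (cases S)
  case (Pt x y)
  have "y = 0" using assms(2) Pt by (auto simp: Let_def split: if_splits)
  then have "x^3 - \<a>\<^sup>2 * x + \<b>^6 = 0" using assms(1) Pt by (simp add: on_curve_def)
  \<comment> \<open>The extra factor \<open>x\<close> brings the cubic into the shape required by
    \<open>rat_root_int\<close>.\<close>
  moreover from this have "x * (x^3 - \<a>\<^sup>2 * x + \<b>^6) = 0" by simp
  then have "x^4 + of_int 0 * x^3 + of_int (- (a\<^sup>2)) * x\<^sup>2 + of_int (b^6) * x + of_int 0 = 0"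
    by (simp add: \<a>_def \<b>_def algebra_simps power2_eq_square power3_eq_cube power4_eq_xxxx)
  then obtain n where "x = of_int n" by (rule rat_root_int)
  ultimately have "of_int (n^3 - a\<^sup>2 * n + b^6) = (0::rat)" by (simp add: \<a>_def \<b>_def)
  then have "n^3 - a\<^sup>2 * n + b^6 = 0" by (simp only: of_int_eq_0_iff)
  then show ?thesis using cubic_no_root[OF a_pos a_less_b] by simp
qed simp

lemma not_double:
  assumes "\<And>l. l^4 - 6*x*l\<^sup>2 - 8*y*l - 3*x\<^sup>2 + 4*\<a>\<^sup>2 \<noteq> 0" "S \<in> carrier E"
  shows "Pt x y \<noteq> S \<otimes>\<^bsub>E\<^esub> S"
proof
  assume "Pt x y = S \<otimes>\<^bsub>E\<^esub> S"
  then have "ec_add A B S S = Pt x y" by simp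
  then obtain l where "l^4 - 6*x*l\<^sup>2 - 8*y*l - 3*x\<^sup>2 - 4*A = 0"
    using halving_quartic[OF nonsing, of S x y] assms(2) by auto
  then show False using assms(1)[of l] by simp
qed

lemma not_double_Q1: "S \<in> carrier E \<Longrightarrow> Q1 \<noteq> S \<otimes>\<^bsub>E\<^esub> S"
proof (rule not_double)
  fix l :: rat
  show "l^4 - 6*\<a>*l\<^sup>2 - 8*\<b>^3*l - 3*\<a>\<^sup>2 + 4*\<a>\<^sup>2 \<noteq> 0"
  proof
    assume e: "l^4 - 6*\<a>*l\<^sup>2 - 8*\<b>^3*l - 3*\<a>\<^sup>2 + 4*\<a>\<^sup>2 = 0"
    then have "l^4 + of_int 0 * l^3 + of_int (- 6*a) * l\<^sup>2 + of_int (- 8*b^3) * l + of_int (a\<^sup>2) = 0"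
      by (simp add: \<a>_def \<b>_def)
    then obtain n where "l = of_int n" by (rule rat_root_int)
    with e have "of_int (n^4 - 6*a*n\<^sup>2 - 8*b^3*n + a\<^sup>2) = (0::rat)" by (simp add: \<a>_def \<b>_def)
    then have "n^4 - 6*a*n\<^sup>2 - 8*b^3*n + a\<^sup>2 = 0" by (simp only: of_int_eq_0_iff)
    then show False using halving_quartic_Q[OF a_pos a_less_b] by simp
  qed
qed

lemma not_double_Q2: "S \<in> carrier E \<Longrightarrow> Q2 \<noteq> S \<otimes>\<^bsub>E\<^esub> S"
proof (rule not_double)
  fix l :: rat
  show "l^4 - 6*(-\<a>)*l\<^sup>2 - 8*\<b>^3*l - 3*(-\<a>)\<^sup>2 + 4*\<a>\<^sup>2 \<noteq> 0"
  proof
    assume e: "l^4 - 6*(-\<a>)*l\<^sup>2 - 8*\<b>^3*l - 3*(-\<a>)\<^sup>2 + 4*\<a>\<^sup>2 = 0"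
    then have "l^4 + of_int 0 * l^3 + of_int (6*a) * l\<^sup>2 + of_int (- 8*b^3) * l + of_int (a\<^sup>2) = 0"
      by (simp add: \<a>_def \<b>_def)
    then obtain n where "l = of_int n" by (rule rat_root_int)
    with e have "of_int (n^4 + 6*a*n\<^sup>2 - 8*b^3*n + a\<^sup>2) = (0::rat)" by (simp add: \<a>_def \<b>_def)
    then have "n^4 + 6*a*n\<^sup>2 - 8*b^3*n + a\<^sup>2 = 0" by (simp only: of_int_eq_0_iff)
    then show False using halving_quartic_Q_neg[OF a_pos a_less_b] by simp
  qed
qed

lemma add_coll:
  assumes "coll A B l m x1 x2 x3" "y1 = l*x1+m" "y2 = l*x2+m"
  shows "Pt x1 y1 \<otimes>\<^bsub>E\<^esub> Pt x2 y2 = Pt x3 (-(l*x3+m))"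
  using ec_add_coll[OF nonsing assms(1)] assms by simp

lemma Q1_Q2: "Q1 \<otimes>\<^bsub>E\<^esub> Q2 = Pt 0 (- (\<b>^3))"
proof -
  have "coll A B 0 (\<b>^3) \<a> (-\<a>) 0"
    unfolding coll_def by (simp add: power2_eq_square power_mult[symmetric])
  from add_coll[OF this, of "\<b>^3" "\<b>^3"] show ?thesis by simp
qed

lemma not_double_Q1_Q2: "S \<in> carrier E \<Longrightarrow> Q1 \<otimes>\<^bsub>E\<^esub> Q2 \<noteq> S \<otimes>\<^bsub>E\<^esub> S"
  unfolding Q1_Q2
proof (rule not_double)
  fix l :: rat
  show "l^4 - 6*0*l\<^sup>2 - 8*(-(\<b>^3))*l - 3*0\<^sup>2 + 4*\<a>\<^sup>2 \<noteq> 0"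
  proof
    assume e: "l^4 - 6*0*l\<^sup>2 - 8*(-(\<b>^3))*l - 3*0\<^sup>2 + 4*\<a>\<^sup>2 = 0"
    then have "l^4 + of_int 0 * l^3 + of_int 0 * l\<^sup>2 + of_int (8*b^3) * l + of_int (4*a\<^sup>2) = 0"
      by (simp add: \<a>_def \<b>_def)
    then obtain n where "l = of_int n" by (rule rat_root_int)
    with e have "of_int ((-n)^4 - 8*b^3*(-n) + 4*a\<^sup>2) = (0::rat)" by (simp add: \<a>_def \<b>_def)
    then have "(-n)^4 - 8*b^3*(-n) + 4*a\<^sup>2 = 0" by (simp only: of_int_eq_0_iff)
    then show False using halving_quartic_P[OF a_pos a_less_b] by metis
  qed
qed

lemma not_double_R: "S \<in> carrier E \<Longrightarrow> R \<noteq> S \<otimes>\<^bsub>E\<^esub> S"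
proof (rule not_double)
  fix l :: rat
  show "l^4 - 6*(-(\<b>\<^sup>2))*l\<^sup>2 - 8*(\<a>*\<b>)*l - 3*(-(\<b>\<^sup>2))\<^sup>2 + 4*\<a>\<^sup>2 \<noteq> 0"
  proof
    assume e: "l^4 - 6*(-(\<b>\<^sup>2))*l\<^sup>2 - 8*(\<a>*\<b>)*l - 3*(-(\<b>\<^sup>2))\<^sup>2 + 4*\<a>\<^sup>2 = 0"
    have "l^4 + 6*\<b>\<^sup>2*l\<^sup>2 - 8*\<a>*\<b>*l - 3*\<b>^4 + 4*\<a>\<^sup>2 = 0"
      using e by (simp add: power2_eq_square power4_eq_xxxx mult_ac)
    then have "\<a> = \<b>\<^sup>2 \<or> \<a> = - \<b>\<^sup>2" by (rule halving_quartic_R) (use b0 in simp)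
    then show False using a_less_b2 a0 by auto
  qed
qed

text \<open>Modulo doubles \<open>Q1\<close> and \<open>-Q1\<close> agree; the sign is chosen
  because the line through \<open>-Q1\<close> and \<open>R\<close> has slope \<open>-\<b>\<close>,
  which keeps the coordinates polynomial.\<close>

lemma inv_Q1_R: "inv\<^bsub>E\<^esub> Q1 \<otimes>\<^bsub>E\<^esub> R = Pt (2*\<b>\<^sup>2 - \<a>) (3*\<b>^3 - 2*\<a>*\<b>)"
proof -
  have "coll A B (-\<b>) (\<a>*\<b> - \<b>^3) \<a> (-(\<b>\<^sup>2)) (2*\<b>\<^sup>2 - \<a>)"
    unfolding coll_def by (intro conjI) algebra+
  from add_coll[OF this, of "-(\<b>^3)" "\<a>*\<b>"] show ?thesis
    using ec_group_inv[OF nonsing on_curve_points(1)]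
    by (simp add: power2_eq_square power3_eq_cube algebra_simps)
qed

lemma not_double_inv_Q1_R: "S \<in> carrier E \<Longrightarrow> inv\<^bsub>E\<^esub> Q1 \<otimes>\<^bsub>E\<^esub> R \<noteq> S \<otimes>\<^bsub>E\<^esub> S"
  unfolding inv_Q1_R
proof (rule not_double)
  fix l :: rat
  show "l^4 - 6*(2*\<b>\<^sup>2 - \<a>)*l\<^sup>2 - 8*(3*\<b>^3 - 2*\<a>*\<b>)*l - 3*(2*\<b>\<^sup>2 - \<a>)\<^sup>2 + 4*\<a>\<^sup>2 \<noteq> 0"
  proof
    assume "l^4 - 6*(2*\<b>\<^sup>2 - \<a>)*l\<^sup>2 - 8*(3*\<b>^3 - 2*\<a>*\<b>)*l - 3*(2*\<b>\<^sup>2 - \<a>)\<^sup>2 + 4*\<a>\<^sup>2 = 0"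
    then have "\<a> = - \<b>\<^sup>2 \<or> \<a> = - 2 * \<b>\<^sup>2" by (rule halving_quartic_RQ) (use b0 in simp)
    moreover have "0 < \<b>\<^sup>2" using b0 by simp
    ultimately show False using a0 by linarith
  qed
qed

lemma Q2_R: "Q2 \<otimes>\<^bsub>E\<^esub> R = Pt (2*\<b>\<^sup>2 + \<a>) (- (3*\<b>^3 + 2*\<a>*\<b>))"
proof -
  have "coll A B \<b> (\<a>*\<b> + \<b>^3) (-\<a>) (-(\<b>\<^sup>2)) (2*\<b>\<^sup>2 + \<a>)"
    unfolding coll_def by (intro conjI) algebra+
  from add_coll[OF this, of "\<b>^3" "\<a>*\<b>"] show ?thesis
    by (simp add: power2_eq_square power3_eq_cube algebra_simps)
qed

lemma not_double_Q2_R: "S \<in> carrier E \<Longrightarrow> Q2 \<otimes>\<^bsub>E\<^esub> R \<noteq> S \<otimes>\<^bsub>E\<^esub> S"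
  unfolding Q2_R
proof (rule not_double)
  fix l :: rat
  show "l^4 - 6*(2*\<b>\<^sup>2 + \<a>)*l\<^sup>2 - 8*(-(3*\<b>^3 + 2*\<a>*\<b>))*l - 3*(2*\<b>\<^sup>2 + \<a>)\<^sup>2 + 4*\<a>\<^sup>2 \<noteq> 0"
  proof
    assume "l^4 - 6*(2*\<b>\<^sup>2 + \<a>)*l\<^sup>2 - 8*(-(3*\<b>^3 + 2*\<a>*\<b>))*l - 3*(2*\<b>\<^sup>2 + \<a>)\<^sup>2 + 4*\<a>\<^sup>2 = 0"
    \<comment> \<open>Changing the signs of \<open>\<a>\<close> and \<open>l\<close> gives the
      quartic of \<open>R - Q1\<close>.\<close>
    then have "(-l)^4 - 6*(2*\<b>\<^sup>2 - (-\<a>))*(-l)\<^sup>2 - 8*(3*\<b>^3 - 2*(-\<a>)*\<b>)*(-l) - 3*(2*\<b>\<^sup>2 - (-\<a>))\<^sup>2 + 4*(-\<a>)\<^sup>2 = 0"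
      by algebra
    then have "-\<a> = - \<b>\<^sup>2 \<or> -\<a> = - 2 * \<b>\<^sup>2" by (rule halving_quartic_RQ) (use b0 in simp)
    then show False using a_less_b2 a0 by auto
  qed
qed

text \<open>The line through \<open>Q1 + Q2\<close> and \<open>R\<close> has slope
  \<open>-s*\<b>\<close>. In the variable \<open>k = -l/\<b> - s\<close> the halving quartic becomes
  linear in \<open>s - 1\<close>, the inverse of the quantity bounded by
  \<open>halving_quartic_RP\<close>.\<close>

lemma double_Q1_Q2_R:
  assumes "S \<in> carrier E" "Q1 \<otimes>\<^bsub>E\<^esub> Q2 \<otimes>\<^bsub>E\<^esub> R = S \<otimes>\<^bsub>E\<^esub> S"
  shows "\<b>\<^sup>2 / \<a> / 8 \<in> Zloc2"
proof -
  define s where "s = \<a> / \<b>\<^sup>2 + 1"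
  have as: "\<a> = (s - 1) * \<b>\<^sup>2" using b0 by (simp add: s_def)
  have "coll A B (- s * \<b>) (-(\<b>^3)) 0 (-(\<b>\<^sup>2)) (\<b>\<^sup>2 * (s\<^sup>2 + 1))"
    unfolding coll_def as by (intro conjI) algebra+
  then have "Pt 0 (-(\<b>^3)) \<otimes>\<^bsub>E\<^esub> R = Pt (\<b>\<^sup>2 * (s\<^sup>2 + 1)) (-(- s * \<b> * (\<b>\<^sup>2 * (s\<^sup>2 + 1)) + (-(\<b>^3))))"
    by (rule add_coll) (simp_all add: as power2_eq_square power3_eq_cube algebra_simps)
  then have "ec_add A B S S = Pt (\<b>\<^sup>2 * (s\<^sup>2 + 1)) (\<b>^3 * (s^3 + s + 1))"
    using assms(2) unfolding Q1_Q2 by (simp add: power2_eq_square power3_eq_cube algebra_simps)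
  then obtain l where l: "l^4 - 6*(\<b>\<^sup>2 * (s\<^sup>2 + 1))*l\<^sup>2 - 8*(\<b>^3 * (s^3 + s + 1))*l - 3*(\<b>\<^sup>2 * (s\<^sup>2 + 1))\<^sup>2 - 4*A = 0"
    using halving_quartic[OF nonsing, of S] assms(1) by auto
  define k where "k = - l / \<b> - s"
  have lk: "l = - (k + s) * \<b>" using b0 by (simp add: k_def)
  have "\<b>^4 * (k^4 + 4*k^3 - 6*k\<^sup>2 + 4*k + 1) = \<b>^4 * (- 4 * (s - 1) * k * (k\<^sup>2 - 1))"
    using l unfolding as lk by algebra
  then have "k^4 + 4*k^3 - 6*k\<^sup>2 + 4*k + 1 = - 4 * (s - 1) * k * (k\<^sup>2 - 1)" using b0 by simp
  moreover have "\<b>\<^sup>2 / \<a> * (s - 1) = 1" using a0 b0 by (simp add: s_def)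
  ultimately have "\<b>\<^sup>2 / \<a> * (k^4 + 4*k^3 - 6*k\<^sup>2 + 4*k + 1) = - 4 * k * (k\<^sup>2 - 1)"
    by algebra
  then show ?thesis by (rule halving_quartic_RP)
qed

lemma double_point:
  assumes "on_curve A B (Pt x y)" "2*l*y = 3*x\<^sup>2 + A"
  shows "Pt x y \<otimes>\<^bsub>E\<^esub> Pt x y = Pt (l\<^sup>2 - 2*x) (l*(3*x - l\<^sup>2) - y)"
proof -
  have e: "y\<^sup>2 = x^3 + A*x + B" using assms(1) by (simp add: on_curve_def)
  have "coll A B l (y - l*x) x x (l\<^sup>2 - 2*x)"
    unfolding coll_def using e assms(2) by (intro conjI) (simp, algebra, algebra)
  from add_coll[OF this, of y y] show ?thesis
    by (simp add: algebra_simps power2_eq_square)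
qed

text \<open>Multiplied by \<open>t\<close>, the tangent slope at \<open>R\<close> is twice a unit of
  \<open>Zloc2\<close> and the one at \<open>2R\<close> is a unit. This puts \<open>2R\<close> just
  outside the subgroup and \<open>4R\<close> inside.\<close>

lemma relation_even_R:
  fixes c1 c2 c3 :: int
  assumes rel: "Q1 [^]\<^bsub>E\<^esub> c1 \<otimes>\<^bsub>E\<^esub> (Q2 [^]\<^bsub>E\<^esub> c2 \<otimes>\<^bsub>E\<^esub> R [^]\<^bsub>E\<^esub> c3) = \<one>\<^bsub>E\<^esub>"
    and g: "\<b>\<^sup>2 / \<a> / 8 \<in> Zloc2"
  shows "even c3"
proof (rule ccontr)
  assume "odd c3"
  define \<gamma> where "\<gamma> = \<b>\<^sup>2 / \<a> / 8"
  define t where "t = 4 * \<b> / \<a>"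
  have \<gamma>: "\<gamma> \<in> Zloc2" "\<gamma> \<noteq> 0" using g a0 b0 by (simp_all add: \<gamma>_def)
  have t0: "t \<noteq> 0" using a0 b0 by (simp add: t_def)
  have at: "\<a> * t\<^sup>2 = 128 * \<gamma>" and bt: "\<b> * t = 32 * \<gamma>"
    using a0 by (simp_all add: \<gamma>_def t_def power2_eq_square)
  have At: "A * t^4 / 2 = - 8192 * \<gamma>\<^sup>2" using at by algebra
  have Bt: "B * t^6 / 2 = 32^6 * \<gamma>^6 / 2" using bt by algebra
  have H: "subgroup (ker_red A B t) E"
  proof (rule ker_red_subgroup[OF nonsing t0])
    show "A * t^4 / 2 \<in> Zloc2" unfolding At using \<gamma> by simp
    show "B * t^6 / 2 \<in> Zloc2" unfolding Bt using \<gamma> by simp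
  qed
  \<comment> \<open>Membership test: the factor \<open>r\<close> turns the scaled ordinate into a
    unit; \<open>r\<close> and \<open>r\<close> times the scaled abscissa then only have to be in
    \<open>Zloc2\<close>.\<close>
  have mem: "Pt x y \<in> ker_red A B t"
    if "on_curve A B (Pt x y)" "r * (y * t^3) = - (1 + 2*v)" "r * (x * t\<^sup>2) = w"
      "r \<in> Zloc2" "v \<in> Zloc2" "w \<in> Zloc2" for x y r v w
  proof -
    have n: "1 + 2*v \<noteq> 0" using Zloc2_unit that by simp
    then have n': "r \<noteq> 0" "y * t^3 \<noteq> 0" using that(2) by auto
    have "x / (y * t) = (r * (x * t\<^sup>2)) / (r * (y * t^3))"
      using n' by (simp add: power2_eq_square power3_eq_cube)
    also have "\<dots> = - (w / (1 + 2*v))" unfolding that by (simp only: minus_divide_right)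
    finally have "x / (y * t) \<in> Zloc2" using Zloc2_divide that by simp
    moreover have "1 / (y * t^3) = r / (r * (y * t^3))" using n' by simp
    then have "1 / (y * t^3) = - (r / (1 + 2*v))" unfolding that by (simp only: minus_divide_right)
    then have "1 / (y * t^3) \<in> Zloc2" using Zloc2_divide that by simp
    ultimately show ?thesis using that n' by (simp add: ker_red_def)
  qed
  have dblQ: "Pt c (\<b>^3) \<otimes>\<^bsub>E\<^esub> Pt c (\<b>^3) \<in> ker_red A B t"
    if c: "on_curve A B (Pt c (\<b>^3))" "c\<^sup>2 = \<a>\<^sup>2" "c * t\<^sup>2 = 128 * d" "d \<in> Zloc2" for c d
  proof -
    define l where "l = \<a>\<^sup>2 / \<b>^3"
    have "l * \<b>^3 = \<a>\<^sup>2" using b0 by (simp add: l_def)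
    then have "2*l*\<b>^3 = 3*c\<^sup>2 + A" using c(2) by simp
    note D = double_point[OF c(1) this]
    have lt: "2 * \<gamma> * (l * t) = 1"
      using a0 b0 by (simp add: \<gamma>_def l_def t_def power2_eq_square power3_eq_cube)
    show ?thesis unfolding D
    \<comment> \<open>By \<open>lt\<close> this is the inverse of \<open>(l*t)^3\<close>, the term
      of the scaled ordinate with the highest power of \<open>\<gamma>\<close> in its
      denominator.\<close>
    proof (rule mem[where r = "8 * \<gamma>^3"])
      show "on_curve A B (Pt (l\<^sup>2 - 2*c) (l*(3*c - l\<^sup>2) - \<b>^3))"
        using m_closed[of "Pt c (\<b>^3)" "Pt c (\<b>^3)"] c(1) unfolding D by simp
      show "8 * \<gamma>^3 * ((l*(3*c - l\<^sup>2) - \<b>^3) * t^3) = - (1 + 2 * (- 768 * \<gamma>\<^sup>2 * d + 131072 * \<gamma>^6))"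
        using lt bt c(3) by algebra
      show "8 * \<gamma>^3 * ((l\<^sup>2 - 2*c) * t\<^sup>2) = 2 * \<gamma> * (1 - 1024 * \<gamma>\<^sup>2 * d)"
        using lt c(3) by algebra
    qed (use \<gamma> c(4) in simp_all)
  qed
  define l where "l = (3*\<b>^4 - \<a>\<^sup>2) / (2*\<a>*\<b>)"
  have "2*l*(\<a>*\<b>) = 3*(-(\<b>\<^sup>2))\<^sup>2 + A" using a0 b0 by (simp add: l_def)
  note DR = double_point[OF on_curve_points(3) this]
  have lt: "l * t = 384 * \<gamma>\<^sup>2 - 2"
    using a0 b0 by (simp add: \<gamma>_def l_def t_def field_simps power2_eq_square power4_eq_xxxx)
  define X where "X = l\<^sup>2 - 2*(-(\<b>\<^sup>2))"
  define Y where "Y = l*(3*(-(\<b>\<^sup>2)) - l\<^sup>2) - \<a>*\<b>"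
  have R2: "R \<otimes>\<^bsub>E\<^esub> R = Pt X Y" using DR by (simp add: X_def Y_def)
  define u where "u = 64 * \<gamma>\<^sup>2 + 18432 * \<gamma>^4"
  define v where "v = 18432 * \<gamma>^4 + 192 * \<gamma>\<^sup>2 - 256 * \<gamma>\<^sup>2 - 96 * \<gamma>\<^sup>2 * (36864 * \<gamma>^4 + 384 * \<gamma>\<^sup>2 + 1)"
  have uv: "u \<in> Zloc2" "v \<in> Zloc2" using \<gamma> by (simp_all add: u_def v_def)
  have Xt: "X * t\<^sup>2 = 4 * (1 + 2*u)" using lt bt unfolding X_def u_def by algebra
  have Yt: "Y * t^3 = 8 * (1 + 2*v)" using lt bt at unfolding Y_def v_def by algebra
  have v0: "1 + 2*v \<noteq> 0" using Zloc2_unit uv by simp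
  have Y0: "Y \<noteq> 0" using Yt v0 by auto
  have cR2: "on_curve A B (Pt X Y)" using m_closed[of R R] on_curve_points R2 by simp
  have "R \<otimes>\<^bsub>E\<^esub> R \<notin> ker_red A B t"
  proof
    assume "R \<otimes>\<^bsub>E\<^esub> R \<in> ker_red A B t"
    then have "X / (Y * t) \<in> Zloc2" unfolding R2 by (simp add: ker_red_def)
    moreover have "X / (Y * t) = (X * t\<^sup>2) / (Y * t^3)" using t0 by (simp add: power2_eq_square power3_eq_cube)
    ultimately have "(X * t\<^sup>2) / (Y * t^3) \<in> Zloc2" by simp
    \<comment> \<open>The quotient is \<open>(1 + 2*u) / (2*(1 + 2*v))\<close>, so this combination
      isolates \<open>1/2\<close>.\<close>
    then have "(1 + 2*v) * ((X * t\<^sup>2) / (Y * t^3)) - u \<in> Zloc2"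
      using uv by (intro Zloc2_diff Zloc2_mult Zloc2_add Zloc2_numeral)
    moreover have "(1 + 2*v) * ((X * t\<^sup>2) / (Y * t^3)) - u = 1 / 2"
      unfolding Xt Yt using v0 by (simp add: field_simps)
    ultimately show False using Zloc2_half by metis
  qed
  moreover have "(R \<otimes>\<^bsub>E\<^esub> R) \<otimes>\<^bsub>E\<^esub> (R \<otimes>\<^bsub>E\<^esub> R) \<in> ker_red A B t"
  proof -
    define k where "k = (3*X\<^sup>2 + A) / (2*Y)"
    have kY: "2*k*Y = 3*X\<^sup>2 + A" using Y0 by (simp add: k_def)
    note D = double_point[OF cR2 kY]
    \<comment> \<open>\<open>16*(1 + 2*p)\<close> is the scaled numerator of \<open>k\<close>, and
      \<open>1 + 2*e\<close> is the quotient of \<open>1 + 2*p\<close> by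
      \<open>1 + 2*v\<close>.\<close>
    define p where "p = 1 + 6*u + 6*u\<^sup>2 - 512*\<gamma>\<^sup>2"
    define e where "e = (p - v) / (1 + 2*v)"
    have e: "e \<in> Zloc2" unfolding e_def by (rule Zloc2_divide) (use uv \<gamma> in \<open>simp_all add: p_def\<close>)
    have "(k * t) * (16 * (1 + 2*v)) = 16 * (1 + 2*p)"
      using kY Xt Yt at unfolding p_def by algebra
    moreover have "(1 + 2*e) * (1 + 2*v) = 1 + 2*p" using v0 by (simp add: e_def field_simps)
    ultimately have "(k * t) * (16 * (1 + 2*v)) = (1 + 2*e) * (16 * (1 + 2*v))" by (simp only: mult_ac)
    then have kt: "k * t = 1 + 2*e" using v0 mult_right_cancel[of "16 * (1 + 2*v)"] by simp
    show ?thesis unfolding R2 D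
    proof (rule mem[where r = 1])
      show "on_curve A B (Pt (k\<^sup>2 - 2*X) (k*(3*X - k\<^sup>2) - Y))"
        using m_closed[of "Pt X Y" "Pt X Y"] cR2 unfolding D by simp
      show "1 * ((k*(3*X - k\<^sup>2) - Y) * t^3) =
          - (1 + 2 * (3*e + 6*e\<^sup>2 + 4*e^3 - 6 * (1 + 2*u) * (1 + 2*e) + 4 * (1 + 2*v)))"
        using kt Xt Yt by algebra
      show "1 * ((k\<^sup>2 - 2*X) * t\<^sup>2) = (1 + 2*e)\<^sup>2 - 8 * (1 + 2*u)"
        using kt Xt by algebra
    qed (use e uv in simp_all)
  qed
  moreover have "Q1 \<otimes>\<^bsub>E\<^esub> Q1 \<in> ker_red A B t"
    by (rule dblQ[OF on_curve_points(1) _ at]) (use \<gamma> in simp_all)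
  moreover have "Q2 \<otimes>\<^bsub>E\<^esub> Q2 \<in> ker_red A B t"
    by (rule dblQ[of _ "-\<gamma>", OF on_curve_points(2)]) (use \<gamma> at in simp_all)
  moreover have "Q1 \<in> carrier E" "Q2 \<in> carrier E" "R \<in> carrier E" using on_curve_points by simp_all
  ultimately show False
    using odd_exponent_in_subgroup[OF H _ _ _ _ _ _ rel \<open>odd c3\<close>] by blast
qed

text \<open>\<open>c3\<close> comes first: if it is odd, halving quartics exclude three of the four
  classes, and in the fourth \<open>double_Q1_Q2_R\<close> supplies the condition under which
  \<open>relation_even_R\<close> makes \<open>c3\<close> even. The classes that remain do not
  involve \<open>R\<close>.\<close>

lemma relation_even:
  fixes c1 c2 c3 :: int
  assumes rel: "Q1 [^]\<^bsub>E\<^esub> c1 \<otimes>\<^bsub>E\<^esub> (Q2 [^]\<^bsub>E\<^esub> c2 \<otimes>\<^bsub>E\<^esub> R [^]\<^bsub>E\<^esub> c3) = \<one>\<^bsub>E\<^esub>"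
  shows "even c1 \<and> even c2 \<and> even c3"
proof -
  have c: "Q1 \<in> carrier E" "Q2 \<in> carrier E" "R \<in> carrier E" using on_curve_points by simp_all
  have sq: "\<exists>S\<in>carrier E. Q1 [^]\<^bsub>E\<^esub> e1 \<otimes>\<^bsub>E\<^esub> (Q2 [^]\<^bsub>E\<^esub> e2 \<otimes>\<^bsub>E\<^esub> R [^]\<^bsub>E\<^esub> e3) = S \<otimes>\<^bsub>E\<^esub> S"
    if "even (e1 - c1)" "even (e2 - c2)" "even (e3 - c3)" for e1 e2 e3 :: int
    using relation_mod_2[OF c rel that] by blast
  have pw: "g [^]\<^bsub>E\<^esub> (-1::int) = inv\<^bsub>E\<^esub> g" if "g \<in> carrier E" for g
    using int_pow_neg[OF that, of 1] int_pow_1[OF that] by simp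
  note simps = c pw int_pow_0 int_pow_1 l_one r_one m_closed inv_closed one_closed
  have "even c3"
  proof (rule ccontr)
    assume o: "odd c3"
    then have n: "\<b>\<^sup>2 / \<a> / 8 \<notin> Zloc2" using relation_even_R[OF rel] by blast
    consider "even c1" "even c2" | "odd c1" "even c2" | "even c1" "odd c2" | "odd c1" "odd c2" by blast
    then show False
    proof cases
      case 1
      have "even (0 - c1)" "even (0 - c2)" "even (1 - c3)" using 1 o by presburger+
      from sq[OF this] obtain S where "S \<in> carrier E" "R = S \<otimes>\<^bsub>E\<^esub> S"
        by (auto simp only: simps)
      then show False using not_double_R by blast
    next
      case 2
      have "even (-1 - c1)" "even (0 - c2)" "even (1 - c3)" using 2 o by presburger+
      from sq[OF this] obtain S where "S \<in> carrier E" "inv\<^bsub>E\<^esub> Q1 \<otimes>\<^bsub>E\<^esub> R = S \<otimes>\<^bsub>E\<^esub> S"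
        by (auto simp only: simps)
      then show False using not_double_inv_Q1_R by blast
    next
      case 3
      have "even (0 - c1)" "even (1 - c2)" "even (1 - c3)" using 3 o by presburger+
      from sq[OF this] obtain S where "S \<in> carrier E" "Q2 \<otimes>\<^bsub>E\<^esub> R = S \<otimes>\<^bsub>E\<^esub> S"
        by (auto simp only: simps)
      then show False using not_double_Q2_R by blast
    next
      case 4
      have "even (1 - c1)" "even (1 - c2)" "even (1 - c3)" using 4 o by presburger+
      from sq[OF this] obtain S where "S \<in> carrier E" "Q1 \<otimes>\<^bsub>E\<^esub> (Q2 \<otimes>\<^bsub>E\<^esub> R) = S \<otimes>\<^bsub>E\<^esub> S"
        by (auto simp only: simps)
      then show False using double_Q1_Q2_R n c m_assoc by metis
    qed
  qed
  consider "even c1" "even c2" | "odd c1" "even c2" | "even c1" "odd c2" | "odd c1" "odd c2" by blast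
  then show ?thesis
  proof cases
    case 1
    then show ?thesis using \<open>even c3\<close> by simp
  next
    case 2
    have "even (1 - c1)" "even (0 - c2)" "even (0 - c3)" using 2 \<open>even c3\<close> by presburger+
    from sq[OF this] obtain S where "S \<in> carrier E" "Q1 = S \<otimes>\<^bsub>E\<^esub> S"
      by (auto simp only: simps)
    then show ?thesis using not_double_Q1 by blast
  next
    case 3
    have "even (0 - c1)" "even (1 - c2)" "even (0 - c3)" using 3 \<open>even c3\<close> by presburger+
    from sq[OF this] obtain S where "S \<in> carrier E" "Q2 = S \<otimes>\<^bsub>E\<^esub> S"
      by (auto simp only: simps)
    then show ?thesis using not_double_Q2 by blast
  next
    case 4
    have "even (1 - c1)" "even (1 - c2)" "even (0 - c3)" using 4 \<open>even c3\<close> by presburger+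
    from sq[OF this] obtain S where "S \<in> carrier E" "Q1 \<otimes>\<^bsub>E\<^esub> Q2 = S \<otimes>\<^bsub>E\<^esub> S"
      by (auto simp only: simps)
    then show ?thesis using not_double_Q1_Q2 by blast
  qed
qed

lemma independent_points: "ec_independent A B [Q1, Q2, R]"
  unfolding ec_independent_def
proof (intro conjI allI impI)
  show "\<forall>P\<in>set [Q1, Q2, R]. on_curve A B P" using on_curve_points by simp
next
  fix cs :: "int list"
  assume len: "length cs = length [Q1, Q2, R]"
    and rel: "foldr (ec_add A B) (map2 (ec_mul A B) cs [Q1, Q2, R]) Inf = Inf"
  obtain c1 c2 c3 where cs: "cs = [c1, c2, c3]"
    using len by (auto simp: length_Suc_conv numeral_3_eq_3)
  have c: "Q1 \<in> carrier E" "Q2 \<in> carrier E" "R \<in> carrier E" using on_curve_points by simp_all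
  have "ec_add A B (R [^]\<^bsub>E\<^esub> c3) Inf = R [^]\<^bsub>E\<^esub> c3" by (cases "R [^]\<^bsub>E\<^esub> c3") simp_all
  then have "Q1 [^]\<^bsub>E\<^esub> c1 \<otimes>\<^bsub>E\<^esub> (Q2 [^]\<^bsub>E\<^esub> c2 \<otimes>\<^bsub>E\<^esub> R [^]\<^bsub>E\<^esub> c3) = \<one>\<^bsub>E\<^esub>"
    using rel unfolding cs by (simp add: ec_mul_pow[OF nonsing] on_curve_points)
  then have "c1 = 0 \<and> c2 = 0 \<and> c3 = 0"
    by (rule independent_if_relations_even[OF c relation_even no_two_torsion, rotated -1])
  then show "\<forall>c\<in>set cs. c = 0" by (simp add: cs)
qed

end

theorem theorem1p3:
  fixes a b :: int
  assumes "0 < a" and "a < b"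
  shows "nonsingular (- ((of_int a)^2)) ((of_int b)^6) \<and>
         mw_rank (- ((of_int a)^2)) ((of_int b)^6) \<ge> 3"
proof -
  interpret two_parameter_curve a b using assms by unfold_locales
  \<comment> \<open>The rank is a supremum, so one independent list is enough.\<close>
  have "enat (length [Q1, Q2, R]) \<le> mw_rank A B"
    unfolding mw_rank_def by (rule SUP_upper) (use independent_points in simp)
  then have "3 \<le> mw_rank A B" by (simp add: numeral_eq_enat numeral_3_eq_3)
  then show ?thesis using nonsing by (simp add: \<a>_def \<b>_def)
qed

end
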